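(* Let $\nu\in(0,1]$ and $0<H<1$ with $\nu+2H-1>0$. A solution $u(x,t)$ to the problem $$ \begin{cases} {}^C D^\nu_{0^+} u(x,t) = H\, t^{2H-1}\, \frac{\partial^2}{\partial x^2} u(x,t), & x\in\mathbb{R},\ t>0,\\ u(x,0)=\delta(x), \end{cases} $$ can be written as $$ u(x,t)= \frac{1}{2\pi}\int_{-\infty}^{+\infty} e^{-i\beta x}\, E_{\nu,\,1+\frac{2H-1}{\nu},\,\frac{2H-1}{\nu}}\left(-H\beta^2 t^{\nu+2H-1}\right)\mathrm{d}\beta . $$
   Context: $\delta$ is the Dirac delta at $0$. ${}^C D^\nu_{0^+}$ is the Caputo derivative in $t$: for $\nu\in(0,1)$, ${}^C D^\nu_{0^+}f(t)=\frac{1}{\Gamma(1-\nu)}\int_0^t (t-s)^{-\nu}f'(s)\,\mathrm ds$, and for $\nu=1$ it is $\mathrm d/\mathrm dt$. The generalized (Kilbas–Saigo) three-index Mittag–Leffler function is $$E_{a,m,l}(z)=1+\sum_{k=1}^\infty z^k\prod_{j=0}^{k-1}\frac{\Gamma\left(a(jm+l)+1\right)}{\Gamma\left(a(jm+l+1)+1\right)},$$ for $a,m>0$, $l\in\mathbb{R}$ with $a(jm+l)\notin\{-1,-2,\dots\}$ for all $j\ge0$. Since the initial datum is $\delta$, the problem is understood through the Fourier transform in $x$, $U(\beta,t)=\int_{\mathbb R}e^{i\beta x}u(x,t)\,\mathrm dx$: for every $\beta\in\mathbb{R}$, ${}^CD^\nu_{0^+}U(\beta,t)=-Ht^{2H-1}\beta^2U(\beta,t)$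 for $t>0$, and $U(\beta,0)=1$. *)

theory Defs
  imports "HOL-Analysis.Analysis"
begin

text \<open>The Kilbas--Saigo function. It is meant for \<open>a, m > 0\<close> and \<open>a (j m + l)\<close> never a negative
  integer; then no \<open>Gamma\<close> factor of a numerator is at a pole, and the series converges for every
  \<open>z\<close>.\<close>

definition kilbas_saigo ::
    "real \<Rightarrow> real \<Rightarrow> real \<Rightarrow> 'a \<Rightarrow> 'a::{real_normed_field, banach}" where
  "kilbas_saigo a m l z =
     1 + (\<Sum>i. let k = Suc i in
            of_real (\<Prod>j<k. Gamma (a * (real j * m + l) + 1) /
                            Gamma (a * (real j * m + l + 1) + 1)) * z ^ k)"

text \<open>Because derivatives and integrals are total functions, the existence of the Caputo derivative
  at \<open>t\<close> is a separate predicate. For \<open>\<nu> < 1\<close> it asks for the classical derivative on \<open>(0, t)\<close> and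
  for (absolute) convergence of the defining integral.\<close>

definition caputo_differentiable ::
    "real \<Rightarrow> (real \<Rightarrow> complex) \<Rightarrow> real \<Rightarrow> bool" where
  "caputo_differentiable \<nu> f t \<longleftrightarrow>
     (if \<nu> = 1 then f differentiable (at t)
      else (\<forall>s\<in>{0<..<t}. f differentiable (at s)) \<and>
           set_integrable lborel {0<..<t}
             (\<lambda>s. (t - s) powr (-\<nu>) *\<^sub>R vector_derivative f (at s)))"

definition caputo_deriv :: "real \<Rightarrow> (real \<Rightarrow> complex) \<Rightarrow> real \<Rightarrow> complex" where
  "caputo_deriv \<nu> f t =
     (if \<nu> = 1 then vector_derivative f (at t)
      else (1 / Gamma (1 - \<nu>)) *\<^sub>R
             (LINT s:{0<..<t}|lborel. (t - s) powr (-\<nu>) *\<^sub>R vector_derivative f (at s)))"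

text \<open>Solutions of \<open>D\<^sup>\<nu> u = H t\<^bsup>2H-1\<^esup> \<partial>\<^sup>2u/\<partial>x\<^sup>2\<close>, \<open>u(\<cdot>,0) = \<delta>\<close>, in the sense of the Fourier
  transform \<open>U(\<beta>,t)\<close> of \<open>u\<close> in \<open>x\<close>. The initial datum is not a function, so the values \<open>u x 0\<close> play
  no role: at \<open>t = 0\<close> the transform is that of \<open>\<delta>\<close>, i.e. \<open>1\<close>. Continuity of \<open>U(\<beta>,\<cdot>)\<close> on \<open>[0,\<infinity>)\<close> is
  what ties the initial value to the values at \<open>t > 0\<close>, since the Caputo derivative only sees \<open>f'\<close>
  on \<open>(0, t)\<close>.\<close>

definition fourier_solution :: "real \<Rightarrow> real \<Rightarrow> (real \<Rightarrow> real \<Rightarrow> complex) \<Rightarrow> bool" where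
  "fourier_solution \<nu> H u \<longleftrightarrow>
     (\<forall>t>0. integrable lborel (\<lambda>x. u x t)) \<and>
     (\<exists>U :: real \<Rightarrow> real \<Rightarrow> complex.
        (\<forall>\<beta>. \<forall>t>0. U \<beta> t = (LINT x|lborel. cis (\<beta> * x) * u x t)) \<and>
        (\<forall>\<beta>. U \<beta> 0 = 1) \<and>
        (\<forall>\<beta>. continuous_on {0..} (U \<beta>)) \<and>
        (\<forall>\<beta>. \<forall>t>0. caputo_differentiable \<nu> (U \<beta>) t \<and>
            caputo_deriv \<nu> (U \<beta>) t =
              - of_real (H * t powr (2 * H - 1) * \<beta>\<^sup>2) * U \<beta> t))"

definition fourier_representation :: "real \<Rightarrow> real \<Rightarrow> real \<Rightarrow> real \<Rightarrow> complex" where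
  "fourier_representation \<nu> H x t =
     of_real (1 / (2 * pi)) *
       (LINT \<beta>|lborel. cis (- (\<beta> * x)) *
          kilbas_saigo \<nu> (1 + (2 * H - 1) / \<nu>) ((2 * H - 1) / \<nu>)
            (of_real (- H * \<beta>\<^sup>2 * t powr (\<nu> + 2 * H - 1))))"

end

theory Submission
  imports Defs "HOL-Probability.Levy"
begin

text \<open>
  Put \<open>\<gamma> = \<nu> + 2H - 1 > 0\<close>, so that \<open>2H - 1 = \<gamma> - \<nu>\<close>. The Caputo derivative of order \<open>\<nu>\<close> maps
  \<open>t\<^bsup>(k+1)\<gamma>\<^esup>\<close> to \<open>t\<^bsup>\<gamma>-\<nu>\<^esup> t\<^bsup>k\<gamma>\<^esup> / \<rho>\<^sub>k\<close> with
  \<open>\<rho>\<^sub>k = \<Gamma>((k+1)\<gamma> + 1 - \<nu>) / \<Gamma>((k+1)\<gamma> + 1)\<close>: it lowers the power of \<open>t\<^bsup>\<gamma>\<^esup>\<close> by one and produces exactly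
  the weight \<open>t\<^bsup>2H-1\<^esup>\<close> of the equation. Hence \<open>\<Sum>\<^sub>k c\<^sub>k (-H \<beta>\<^sup>2 t\<^bsup>\<gamma>\<^esup>)\<^sup>k\<close> solves the equation for the
  Fourier transform at frequency \<open>\<beta>\<close> when \<open>c\<^sub>k = \<rho>\<^sub>0 \<cdots> \<rho>\<^bsub>k-1\<^esub>\<close>, and this is the
  Kilbas--Saigo function (\<open>caputo_series_solution\<close>, \<open>kilbas_saigo_eq\<close>). It remains to see that it is the only
  solution, and that it is the Fourier transform of an integrable function.

  Both rest on a maximum principle (\<open>caputo_nonpos_at_min\<close>, \<open>caputo_comparison\<close>): at a minimum over the past
  the Caputo derivative is nonpositive, so a function whose Caputo derivative is positive wherever the
  function itself is negative stays nonnegative. Applied to arbitrary complex multiples of the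
  difference of two solutions, plus a fixed positive supersolution, it gives uniqueness of the Fourier transform
  (\<open>caputo_linear_equation_unique\<close>), and the Fourier transform determines an integrable function
  almost everywhere (\<open>fourier_unique\<close>).

  Write \<open>E(x) = \<Sum>\<^sub>k c\<^sub>k (-x)\<^sup>k\<close>. The alternating series does not show how \<open>E\<close> behaves at infinity, but the
  maximum principle does. The functions \<open>Z\<^sub>n(t) = (-x)\<^sup>n E\<^bsup>(n)\<^esup>(x) / n!\<close> at \<open>x = t\<^bsup>\<gamma>\<^esup>\<close> satisfy
  \<open>D\<^sup>\<nu> Z\<^bsub>n+1\<^esub> = t\<^bsup>\<gamma>-\<nu>\<^esup> (Z\<^sub>n - Z\<^bsub>n+1\<^esub>)\<close> by the Pascal rule, so they are all nonnegative by induction: \<open>E\<close>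
  is completely monotone (\<open>E_completely_monotone\<close>). Being decreasing, \<open>E\<close> can be pulled out of the
  integrated form of its equation, which gives \<open>E(x) = O(1/x)\<close>; monotonicity of the successive
  derivatives improves this to \<open>E\<^bsup>(n)\<^esup>(x) = O(x\<^bsup>-(n+1)\<^esup>)\<close> (\<open>dE_decay\<close>). So \<open>\<beta> \<mapsto> E(\<kappa> \<beta>\<^sup>2)\<close> and its
  first two derivatives are \<open>O(1/(1 + \<beta>\<^sup>2))\<close>, its inverse Fourier transform is integrable, and Fourier
  inversion applies (\<open>E_inverse_transform\<close>).
\<close>

section \<open>Fourier integrals on the real line\<close>

lemma cis_borel_measurable [measurable]: "cis \<in> borel_measurable borel"
  by (intro borel_measurable_continuous_onI continuous_intros)

lemma integrable_cis_mult:
  fixes f :: "real \<Rightarrow> complex"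
  assumes "integrable lborel f" and [measurable]: "g \<in> borel_measurable borel"
  shows "integrable lborel (\<lambda>x. cis (g x) * f x)"
proof -
  have [measurable]: "f \<in> borel_measurable borel"
    using borel_measurable_integrable[OF assms(1)] by simp
  show ?thesis
    by (rule Bochner_Integration.integrable_bound[OF assms(1)]) (auto simp: norm_mult)
qed

lemma integral_derivative_eq_0:
  fixes G g :: "real \<Rightarrow> complex"
  assumes "\<And>x. (G has_vector_derivative g x) (at x)" "\<And>x. isCont g x" "integrable lborel g"
    and "(G \<longlongrightarrow> 0) at_top" "(G \<longlongrightarrow> 0) at_bot"
  shows "integral\<^sup>L lborel g = 0"
proof -
  have "(LBINT x=-\<infinity>..\<infinity>. g x) = 0 - 0"
  proof (rule interval_integral_FTC_integrable)
    show "((G \<circ> real_of_ereal) \<longlongrightarrow> 0) (at_right (-\<infinity>))"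
      using assms(5) by (simp add: ereal_tendsto_simps)
    show "((G \<circ> real_of_ereal) \<longlongrightarrow> 0) (at_left \<infinity>)"
      using assms(4) by (simp add: ereal_tendsto_simps)
    show "set_integrable lborel (einterval (-\<infinity>) \<infinity>) g"
      using assms(3) by (simp add: set_integrable_def)
  qed (use assms in auto)
  then show ?thesis
    by (simp add: interval_lebesgue_integral_def set_lebesgue_integral_def)
qed

lemma integrable_over_1_plus_square: "integrable lborel (\<lambda>x::real. K / (1 + x\<^sup>2))"
proof -
  have "integrable lborel (\<lambda>x::real. inverse (1 + x\<^sup>2))"
    using integrable_inverse_1_plus_square by (simp add: set_integrable_def)
  from integrable_mult_right[OF this, of K] show ?thesis by (simp add: divide_inverse)
qed

lemma tendsto_over_1_plus_square:
  "((\<lambda>x::real. K / (1 + x\<^sup>2)) \<longlongrightarrow> 0) at_top" "((\<lambda>x::real. K / (1 + x\<^sup>2)) \<longlongrightarrow> 0) at_bot"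
proof -
  have top: "filterlim (\<lambda>x::real. 1 + x\<^sup>2) at_top at_top"
    by (intro filterlim_tendsto_add_at_top[OF tendsto_const] filterlim_pow_at_top filterlim_ident) auto
  have bot: "filterlim (\<lambda>x::real. 1 + x\<^sup>2) at_top at_bot"
    using top by (simp add: filterlim_at_bot_mirror)
  show "((\<lambda>x::real. K / (1 + x\<^sup>2)) \<longlongrightarrow> 0) at_top" "((\<lambda>x::real. K / (1 + x\<^sup>2)) \<longlongrightarrow> 0) at_bot"
    by (rule real_tendsto_divide_at_top[OF tendsto_const], rule top)
       (rule real_tendsto_divide_at_top[OF tendsto_const], rule bot)
qed

text \<open>Integration by parts: the derivative of \<open>cis (- (b * x)) * G b\<close> integrates to \<open>0\<close> because \<open>G\<close>
  vanishes at both ends.\<close>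

lemma fourier_integral_deriv:
  fixes G g :: "real \<Rightarrow> complex"
  assumes der: "\<And>b. (G has_vector_derivative g b) (at b)" and cont: "\<And>b. isCont g b"
    and bG: "\<And>b. norm (G b) \<le> K / (1 + b\<^sup>2)" and int: "integrable lborel G" "integrable lborel g"
  shows "(LINT b|lborel. cis (- (b * x)) * g b) = \<i> * x * (LINT b|lborel. cis (- (b * x)) * G b)"
proof -
  let ?e = "\<lambda>b. cis (- (b * x))"
  have contG: "isCont G b" for b
    using der[of b] by (rule has_vector_derivative_continuous)
  have "LINT b|lborel. (?e b * g b - \<i> * x * (?e b * G b)) = 0"
  proof (rule integral_derivative_eq_0[where G = "\<lambda>b. ?e b * G b"])
    fix b
    have e: "(?e has_vector_derivative (- (\<i> * x) * ?e b)) (at b)"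
    proof -
      have "((\<lambda>z. exp (- (\<i> * x) * z)) has_field_derivative - (\<i> * x) * exp (- (\<i> * x) * of_real b)) (at (of_real b))"
        by (auto intro!: derivative_eq_intros)
      from has_vector_derivative_real_field[OF this] show ?thesis
        by (simp add: cis_conv_exp mult_ac)
    qed
    show "((\<lambda>b. ?e b * G b) has_vector_derivative (?e b * g b - \<i> * x * (?e b * G b))) (at b)"
      using has_vector_derivative_mult[OF e der[of b]] by (simp add: algebra_simps)
    show "isCont (\<lambda>b. ?e b * g b - \<i> * x * (?e b * G b)) b"
      by (intro continuous_intros cont contG has_vector_derivative_continuous[OF e])
  next
    show "integrable lborel (\<lambda>b. ?e b * g b - \<i> * x * (?e b * G b))"
      by (intro Bochner_Integration.integrable_diff integrable_mult_right integrable_cis_mult int) auto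
    have *: "norm (?e b * G b) \<le> K / (1 + b\<^sup>2)" for b
      using bG[of b] by (simp add: norm_mult)
    show "((\<lambda>b. ?e b * G b) \<longlongrightarrow> 0) at_top"
      by (rule Lim_null_comparison[OF always_eventually tendsto_over_1_plus_square(1)]) (use * in blast)
    show "((\<lambda>b. ?e b * G b) \<longlongrightarrow> 0) at_bot"
      by (rule Lim_null_comparison[OF always_eventually tendsto_over_1_plus_square(2)]) (use * in blast)
  qed
  then show ?thesis
    by (subst (asm) Bochner_Integration.integral_diff)
       (auto intro!: integrable_mult_right integrable_cis_mult int)
qed

text \<open>Two integrations by parts bound \<open>(1 + x\<^sup>2)\<close> times the transform of \<open>F\<close> by
  \<open>\<integral> (\<bar>F\<bar> + \<bar>F2\<bar>)\<close>, where \<open>F2\<close> is the second derivative of \<open>F\<close>.\<close>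

lemma fourier_integral_integrable:
  fixes F F1 F2 :: "real \<Rightarrow> complex"
  assumes der: "\<And>b. (F has_vector_derivative F1 b) (at b)" "\<And>b. (F1 has_vector_derivative F2 b) (at b)"
    and cont: "\<And>b. isCont F2 b"
    and bound: "\<And>b. norm (F b) \<le> K / (1 + b\<^sup>2)" "\<And>b. norm (F1 b) \<le> K / (1 + b\<^sup>2)"
      "\<And>b. norm (F2 b) \<le> K / (1 + b\<^sup>2)"
  shows "integrable lborel F" "integrable lborel (\<lambda>x. LINT b|lborel. cis (- (b * x)) * F b)"
proof -
  have contF: "isCont F b" and contF1: "isCont F1 b" for b
    using der(1,2)[of b] by (auto intro: has_vector_derivative_continuous)
  have [measurable]: "F \<in> borel_measurable borel" "F1 \<in> borel_measurable borel" "F2 \<in> borel_measurable borel"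
    using contF contF1 cont
    by (auto intro!: borel_measurable_continuous_onI simp: continuous_on_eq_continuous_at)
  have int: "integrable lborel G" if "G \<in> borel_measurable borel" "\<And>b. norm (G b) \<le> K / (1 + b\<^sup>2)"
    for G :: "real \<Rightarrow> complex"
  proof (rule Bochner_Integration.integrable_bound[OF integrable_over_1_plus_square[of K]])
    show "AE b in lborel. norm (G b) \<le> norm (K / (1 + b\<^sup>2))"
      unfolding real_norm_def by (intro AE_I2 order_trans[OF that(2) abs_ge_self])
  qed (use that in auto)
  have F: "integrable lborel F" and F1: "integrable lborel F1" and F2: "integrable lborel F2"
    using bound by (auto intro!: int)
  show "integrable lborel F" by (rule F)
  let ?u = "\<lambda>x. LINT b|lborel. cis (- (b * x)) * F b"
  define M where "M = (LINT b|lborel. norm (F b) + norm (F2 b))"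
  have "norm (?u x) \<le> M / (1 + x\<^sup>2)" for x
  proof -
    have "(LINT b|lborel. cis (- (b * x)) * F2 b) = \<i> * x * (\<i> * x * ?u x)"
      using fourier_integral_deriv[OF der(2) cont bound(2) F1 F2, of x]
        fourier_integral_deriv[OF der(1) contF1 bound(1) F F1, of x] by simp
    also have "\<dots> = (\<i> * \<i>) * of_real (x\<^sup>2) * ?u x"
      by (simp only: power2_eq_square of_real_mult mult_ac)
    also have "\<dots> = - of_real (x\<^sup>2) * ?u x" by simp
    finally have "(1 + x\<^sup>2) *\<^sub>R ?u x = ?u x - (LINT b|lborel. cis (- (b * x)) * F2 b)"
      by (simp add: scaleR_conv_of_real algebra_simps)
    also have "\<dots> = (LINT b|lborel. cis (- (b * x)) * F b - cis (- (b * x)) * F2 b)"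
      by (rule Bochner_Integration.integral_diff[symmetric]) (auto intro!: integrable_cis_mult F F2)
    also have "norm \<dots> \<le> M"
      unfolding M_def
    proof (rule Bochner_Integration.integral_norm_bound_integral)
      fix b
      show "norm (cis (- (b * x)) * F b - cis (- (b * x)) * F2 b) \<le> norm (F b) + norm (F2 b)"
        using norm_triangle_ineq4[of "cis (- (b * x)) * F b" "cis (- (b * x)) * F2 b"]
        by (simp add: norm_mult)
    qed (auto intro!: integrable_cis_mult F F2)
    finally have "(1 + x\<^sup>2) * norm (?u x) \<le> M" by (simp add: norm_scaleR)
    moreover have "1 + x\<^sup>2 > 0" by (smt (verit) zero_le_power2)
    ultimately show ?thesis by (simp add: field_simps)
  qed
  then have "AE x in lborel. norm (?u x) \<le> norm (M / (1 + x\<^sup>2))"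
    unfolding real_norm_def by (intro AE_I2 order_trans[OF _ abs_ge_self])
  then show "integrable lborel ?u"
    by (rule Bochner_Integration.integrable_bound[OF integrable_over_1_plus_square[of M], rotated]) simp
qed

lemma gaussian_fourier_integral:
  "(LINT z|lborel. cis (y * z) * of_real (std_normal_density z)) = of_real (exp (- y\<^sup>2 / 2))"
proof -
  have "char std_normal_distribution y = (LINT z|lborel. std_normal_density z *\<^sub>R iexp (y * z))"
    unfolding char_def by (rule integral_density) auto
  then show ?thesis
    by (simp add: char_std_normal_distribution cis_conv_exp scaleR_conv_of_real mult.commute)
qed

text \<open>The transform of \<open>u\<close> is damped by the Gaussian \<open>exp (- (e x)\<^sup>2 / 2)\<close>. By Fubini the damped integral
  is the average of \<open>F\<close> against a normal density of standard deviation \<open>e\<close> centred at \<open>b\<close>, which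
  tends to \<open>F b\<close> as \<open>e \<rightarrow> 0\<close>, while dominated convergence removes the damping.\<close>

lemma fourier_inversion:
  fixes F :: "real \<Rightarrow> complex"
  assumes F: "integrable lborel F" and cont: "\<And>b. isCont F b" and bdd: "\<And>b. norm (F b) \<le> K"
  defines "u \<equiv> \<lambda>x. of_real (1 / (2 * pi)) * (LINT b|lborel. cis (- (b * x)) * F b)"
  assumes u: "integrable lborel u"
  shows "(LINT x|lborel. cis (b * x) * u x) = F b"
proof -
  have [measurable]: "F \<in> borel_measurable borel"
    using borel_measurable_integrable[OF F] by simp
  have [measurable]: "u \<in> borel_measurable borel"
    using borel_measurable_integrable[OF u] by simp
  define e :: "nat \<Rightarrow> real" where "e n = 1 / real (Suc n)" for n
  have e_pos: "e n > 0" for n by (simp add: e_def)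
  have e_lim: "e \<longlonglongrightarrow> 0" unfolding e_def using LIMSEQ_inverse_real_of_nat by (simp add: inverse_eq_divide)
  let ?\<phi> = std_normal_density
  have int_phi: "integrable lborel ?\<phi>" and phi1: "integral\<^sup>L lborel ?\<phi> = 1"
    using integrable_normal_moment[of 1 0 0] integral_normal_density[of 1 0] by (auto simp: integrable_normal_density)
  define A where "A n = (LINT x|lborel. cis (b * x) * u x * of_real (exp (- (e n * x)\<^sup>2 / 2)))" for n
  have lim1: "A \<longlonglongrightarrow> (LINT x|lborel. cis (b * x) * u x)"
    unfolding A_def
  proof (rule integral_dominated_convergence[where w = "\<lambda>x. norm (u x)"])
    show "AE x in lborel. (\<lambda>n. cis (b * x) * u x * of_real (exp (- (e n * x)\<^sup>2 / 2))) \<longlonglongrightarrow> cis (b * x) * u x"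
      by (auto intro!: tendsto_eq_intros e_lim)
    show "AE x in lborel. norm (cis (b * x) * u x * of_real (exp (- (e n * x)\<^sup>2 / 2))) \<le> norm (u x)" for n
      by (auto simp: norm_mult intro!: mult_left_le)
  qed (use u in auto)
  have A: "A n = (LINT z|lborel. F (b + e n * z) * of_real (?\<phi> z))" for n
  proof -
    have "A n = (LINT x|lborel. (LINT \<beta>|lborel.
        of_real (1 / (2 * pi) * exp (- (e n * x)\<^sup>2 / 2)) * (cis ((b - \<beta>) * x) * F \<beta>)))"
      unfolding A_def
    proof (intro Bochner_Integration.integral_cong refl)
      fix x
      have "cis (b * x) * u x * of_real (exp (- (e n * x)\<^sup>2 / 2)) =
          (cis (b * x) * of_real (1 / (2 * pi) * exp (- (e n * x)\<^sup>2 / 2))) * (LINT \<beta>|lborel. cis (- (\<beta> * x)) * F \<beta>)"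
        by (simp add: u_def)
      also have "\<dots> = (LINT \<beta>|lborel. (cis (b * x) * of_real (1 / (2 * pi) * exp (- (e n * x)\<^sup>2 / 2))) * (cis (- (\<beta> * x)) * F \<beta>))"
        by (rule integral_mult_right_zero[symmetric])
      also have "\<dots> = (LINT \<beta>|lborel. of_real (1 / (2 * pi) * exp (- (e n * x)\<^sup>2 / 2)) * (cis ((b - \<beta>) * x) * F \<beta>))"
      proof (intro Bochner_Integration.integral_cong refl)
        fix \<beta>
        have *: "cis ((b - \<beta>) * x) = cis (b * x) * cis (- (\<beta> * x))"
          unfolding cis_mult by (simp add: algebra_simps)
        show "cis (b * x) * of_real (1 / (2 * pi) * exp (- (e n * x)\<^sup>2 / 2)) * (cis (- (\<beta> * x)) * F \<beta>) =
            of_real (1 / (2 * pi) * exp (- (e n * x)\<^sup>2 / 2)) * (cis ((b - \<beta>) * x) * F \<beta>)"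
          unfolding * by (simp only: mult_ac)
      qed
      finally show "cis (b * x) * u x * of_real (exp (- (e n * x)\<^sup>2 / 2)) =
        (LINT \<beta>|lborel. of_real (1 / (2 * pi) * exp (- (e n * x)\<^sup>2 / 2)) * (cis ((b - \<beta>) * x) * F \<beta>))" .
    qed
    also have "\<dots> = (LINT \<beta>|lborel. (LINT x|lborel.
        of_real (1 / (2 * pi) * exp (- (e n * x)\<^sup>2 / 2)) * (cis ((b - \<beta>) * x) * F \<beta>)))"
    proof (rule lborel_pair.Fubini_integral)
      have g: "integrable lborel (\<lambda>x. 1 / (2 * pi) * exp (- (e n * x)\<^sup>2 / 2))"
      proof -
        have "integrable lborel (\<lambda>x. ?\<phi> (0 + e n * x))"
          using e_pos[of n] by (intro lborel_integrable_real_affine int_phi) auto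
        from integrable_mult_right[OF this, of "sqrt (2 * pi) / (2 * pi)"] show ?thesis
          by (simp add: std_normal_density_def)
      qed
      show "integrable (lborel \<Otimes>\<^sub>M lborel) (\<lambda>(\<beta>, x).
          of_real (1 / (2 * pi) * exp (- (e n * x)\<^sup>2 / 2)) * (cis ((b - \<beta>) * x) * F \<beta>))"
      proof (rule lborel_pair.Fubini_integrable)
        show "AE \<beta> in lborel. integrable lborel (\<lambda>x. case (\<beta>, x) of (\<beta>, x) \<Rightarrow>
            of_real (1 / (2 * pi) * exp (- (e n * x)\<^sup>2 / 2)) * (cis ((b - \<beta>) * x) * F \<beta>))"
          apply (rule AE_I2)
          subgoal for \<beta>
            apply (rule Bochner_Integration.integrable_bound[OF integrable_mult_right[OF g, of "norm (F \<beta>)"]])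
            by (auto simp: norm_mult norm_divide mult.commute)
          done
        have "(LINT x|lborel. norm (of_real (1 / (2 * pi) * exp (- (e n * x)\<^sup>2 / 2)) * (cis ((b - \<beta>) * x) * F \<beta>))) =
            (LINT x|lborel. 1 / (2 * pi) * exp (- (e n * x)\<^sup>2 / 2)) * norm (F \<beta>)" for \<beta>
          by (simp add: norm_mult norm_divide)
        then show "integrable lborel (\<lambda>\<beta>. LINT x|lborel. norm (case (\<beta>, x) of (\<beta>, x) \<Rightarrow>
            of_real (1 / (2 * pi) * exp (- (e n * x)\<^sup>2 / 2)) * (cis ((b - \<beta>) * x) * F \<beta>)))"
          using F by simp
      qed simp
    qed
    also have "\<dots> = (LINT \<beta>|lborel. of_real (1 / e n) * (F \<beta> * of_real (?\<phi> ((\<beta> - b) / e n))))"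
    proof (intro Bochner_Integration.integral_cong refl)
      fix \<beta>
      let ?y = "(b - \<beta>) / e n"
      have "(LINT x|lborel. of_real (1 / (2 * pi) * exp (- (e n * x)\<^sup>2 / 2)) * (cis ((b - \<beta>) * x) * F \<beta>)) =
        of_real \<bar>1 / e n\<bar> * (LINT z|lborel. of_real (1 / (2 * pi) * exp (- (e n * (0 + 1 / e n * z))\<^sup>2 / 2)) * (cis ((b - \<beta>) * (0 + 1 / e n * z)) * F \<beta>))"
        using e_pos[of n] by (subst lborel_integral_real_affine[where c = "1 / e n" and t = 0])
          (auto simp: scaleR_conv_of_real)
      also have "\<dots> = of_real (1 / e n) * (LINT z|lborel. (of_real (1 / sqrt (2 * pi)) * F \<beta>) * (cis (?y * z) * of_real (?\<phi> z)))"
      proof -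
        have "1 / (2 * pi) = 1 / sqrt (2 * pi) * (1 / sqrt (2 * pi))"
          by simp
        then show ?thesis
          using e_pos[of n] by (simp add: std_normal_density_def algebra_simps flip: of_real_mult)
      qed
      also have "\<dots> = of_real (1 / e n) * (of_real (1 / sqrt (2 * pi)) * F \<beta> * of_real (exp (- ?y\<^sup>2 / 2)))"
        unfolding integral_mult_right_zero gaussian_fourier_integral by simp
      also have "\<dots> = of_real (1 / e n) * (F \<beta> * of_real (?\<phi> ((\<beta> - b) / e n)))"
        by (simp add: std_normal_density_def power2_commute power_divide)
      finally show "(LINT x|lborel. of_real (1 / (2 * pi) * exp (- (e n * x)\<^sup>2 / 2)) * (cis ((b - \<beta>) * x) * F \<beta>)) = of_real (1 / e n) * (F \<beta> * of_real (?\<phi> ((\<beta> - b) / e n)))" .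
    qed
    also have "\<dots> = \<bar>e n\<bar> *\<^sub>R (LINT z|lborel. of_real (1 / e n) * (F (b + e n * z) * of_real (?\<phi> ((b + e n * z - b) / e n))))"
      using e_pos[of n] by (intro lborel_integral_real_affine) auto
    also have "\<dots> = (LINT z|lborel. F (b + e n * z) * of_real (?\<phi> z))"
      using e_pos[of n] by (simp add: scaleR_conv_of_real)
    finally show ?thesis .
  qed
  have lim2: "(\<lambda>n. LINT z|lborel. F (b + e n * z) * of_real (?\<phi> z)) \<longlonglongrightarrow> (LINT z|lborel. F b * of_real (?\<phi> z))"
  proof (rule integral_dominated_convergence[where w = "\<lambda>z. K * ?\<phi> z"])
    show "AE z in lborel. (\<lambda>n. F (b + e n * z) * of_real (?\<phi> z)) \<longlonglongrightarrow> F b * of_real (?\<phi> z)"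
    proof (rule AE_I2)
      fix z
      have "(\<lambda>n. b + e n * z) \<longlonglongrightarrow> b" by (auto intro!: tendsto_eq_intros e_lim)
      from isCont_tendsto_compose[OF cont this]
      show "(\<lambda>n. F (b + e n * z) * of_real (?\<phi> z)) \<longlonglongrightarrow> F b * of_real (?\<phi> z)"
        by (intro tendsto_intros)
    qed
    show "AE z in lborel. norm (F (b + e n * z) * of_real (?\<phi> z)) \<le> K * ?\<phi> z" for n
      by (auto simp: norm_mult intro!: mult_right_mono bdd)
  qed (use int_phi in auto)
  have "(LINT z|lborel. F b * of_real (?\<phi> z)) = F b"
    using phi1 by simp
  then show ?thesis
    using LIMSEQ_unique[OF lim1] lim2 unfolding A by simp
qed

text \<open>The positive and negative parts of \<open>f\<close> have the same transform. At frequency \<open>0\<close> this says that they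
  have the same mass; after division by it they are two probability densities with the same
  characteristic function, and the uniqueness theorem of Levy applies.\<close>

lemma fourier_eq_0_real:
  fixes f :: "real \<Rightarrow> real"
  assumes f: "integrable lborel f"
    and 0: "\<And>b. (LINT x|lborel. cis (b * x) * of_real (f x)) = 0"
  shows "AE x in lborel. f x = 0"
proof -
  have [measurable]: "f \<in> borel_measurable borel"
    using borel_measurable_integrable[OF f] by simp
  define p m where "p x = max 0 (f x)" and "m x = max 0 (- f x)" for x
  have [measurable]: "p \<in> borel_measurable borel" "m \<in> borel_measurable borel"
    by (auto simp: p_def[abs_def] m_def[abs_def])
  have pm: "f x = p x - m x" "0 \<le> p x" "0 \<le> m x" for x by (auto simp: p_def m_def)
  have p: "integrable lborel p" and m: "integrable lborel m"
    using f by (auto simp: p_def[abs_def] m_def[abs_def])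
  have eq: "(LINT x|lborel. cis (b * x) * of_real (p x)) = (LINT x|lborel. cis (b * x) * of_real (m x))" for b
  proof -
    have "(LINT x|lborel. cis (b * x) * of_real (p x) - cis (b * x) * of_real (m x)) = 0"
      using 0[of b] by (simp add: pm algebra_simps)
    then show ?thesis
      by (subst (asm) Bochner_Integration.integral_diff)
         (auto intro!: integrable_cis_mult integrable_of_real p m)
  qed
  define c where "c = integral\<^sup>L lborel p"
  have c_m: "c = integral\<^sup>L lborel m"
    using eq[of 0] by (simp add: c_def)
  show ?thesis
  proof (cases "c = 0")
    case True
    have "AE x in lborel. p x = 0" "AE x in lborel. m x = 0"
      using integral_nonneg_eq_0_iff_AE[OF p] integral_nonneg_eq_0_iff_AE[OF m] True c_m pm
      by (auto simp: c_def)
    then show ?thesis by eventually_elim (simp add: pm)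
  next
    case False
    have "c \<ge> 0" unfolding c_def using pm by (intro Bochner_Integration.integral_nonneg) auto
    with False have c: "c > 0" by simp
    have prob: "real_distribution (density lborel (\<lambda>x. ennreal (q x / c)))"
      if q: "integrable lborel q" "\<And>x. 0 \<le> q x" "integral\<^sup>L lborel q = c" for q
    proof -
      have [measurable]: "q \<in> borel_measurable borel"
        using borel_measurable_integrable[OF q(1)] by simp
      have "emeasure (density lborel (\<lambda>x. ennreal (q x / c))) UNIV = (\<integral>\<^sup>+ x. ennreal (q x / c) \<partial>lborel)"
        by (simp add: emeasure_density)
      also have "\<dots> = ennreal (LINT x|lborel. q x / c)"
        using q c by (intro nn_integral_eq_integral) auto
      also have "\<dots> = 1" using q c by simp
      finally show ?thesis
        by (auto simp: real_distribution_def real_distribution_axioms_def intro!: prob_spaceI)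
    qed
    have ch: "char (density lborel (\<lambda>x. ennreal (q x / c))) b = (LINT x|lborel. cis (b * x) * of_real (q x)) / c"
      if q: "integrable lborel q" "\<And>x. 0 \<le> q x" for q b
    proof -
      have [measurable]: "q \<in> borel_measurable borel"
        using borel_measurable_integrable[OF q(1)] by simp
      have "char (density lborel (\<lambda>x. ennreal (q x / c))) b = (LINT x|lborel. (q x / c) *\<^sub>R iexp (b * x))"
        unfolding char_def using q(2) c by (intro integral_density) auto
      also have "\<dots> = (LINT x|lborel. (cis (b * x) * of_real (q x)) / c)"
        by (simp add: cis_conv_exp scaleR_conv_of_real mult.commute)
      finally show ?thesis by simp
    qed
    have "density lborel (\<lambda>x. ennreal (p x / c)) = density lborel (\<lambda>x. ennreal (m x / c))"
      by (intro Levy_uniqueness prob p m) (simp_all add: pm ch p m eq c_m[symmetric] c_def[symmetric] fun_eq_iff)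
    then have "AE x in lborel. ennreal (p x / c) = ennreal (m x / c)"
      by (subst (asm) sigma_finite_measure.density_unique_iff[OF lborel.sigma_finite_measure_axioms]) auto
    then show ?thesis
      by eventually_elim (use c pm in \<open>auto simp: ennreal_inj\<close>)
  qed
qed

text \<open>The transform of \<open>cnj \<circ> w\<close> at \<open>b\<close> is the conjugate of that of \<open>w\<close> at \<open>- b\<close>. So if the transform of
  \<open>w = u - v\<close> vanishes, those of its real and imaginary parts do.\<close>

lemma fourier_unique:
  fixes u v :: "real \<Rightarrow> complex"
  assumes u: "integrable lborel u" and v: "integrable lborel v"
    and eq: "\<And>b. (LINT x|lborel. cis (b * x) * u x) = (LINT x|lborel. cis (b * x) * v x)"
  shows "AE x in lborel. u x = v x"
proof -
  define w where "w x = u x - v x" for x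
  have w: "integrable lborel w" unfolding w_def using u v by auto
  have w0: "(LINT x|lborel. cis (b * x) * w x) = 0" for b
    using Bochner_Integration.integral_diff[OF integrable_cis_mult[OF u, of "\<lambda>x. b * x"] integrable_cis_mult[OF v, of "\<lambda>x. b * x"]] eq[of b]
    by (simp add: w_def right_diff_distrib)
  have cw0: "(LINT x|lborel. cis (b * x) * cnj (w x)) = 0" for b
  proof -
    have "(LINT x|lborel. cis (b * x) * cnj (w x)) = (LINT x|lborel. cnj (cis ((-b) * x) * w x))"
      by (simp add: cis_cnj)
    also have "\<dots> = cnj (LINT x|lborel. cis ((-b) * x) * w x)"
      by (rule Bochner_Integration.integral_cnj)
    finally show ?thesis unfolding w0 by simp
  qed
  have cw: "integrable lborel (\<lambda>x. cnj (w x))" using w by simp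
  have re: "AE x in lborel. Re (w x) = 0"
  proof (rule fourier_eq_0_real)
    show "(LINT x|lborel. cis (b * x) * of_real (Re (w x))) = 0" for b
    proof -
      have "(LINT x|lborel. cis (b * x) * of_real (Re (w x))) =
          (LINT x|lborel. (cis (b * x) * w x + cis (b * x) * cnj (w x)) / 2)"
        by (intro Bochner_Integration.integral_cong refl)
           (simp add: complex_add_cnj flip: distrib_left)
      also have "\<dots> = 0"
        by (simp, subst Bochner_Integration.integral_add)
           (auto intro!: integrable_cis_mult w cw simp: w0 cw0 simp del: complex_integrable_cnj)
      finally show ?thesis .
    qed
  qed (use w in auto)
  have im: "AE x in lborel. Im (w x) = 0"
  proof (rule fourier_eq_0_real)
    show "(LINT x|lborel. cis (b * x) * of_real (Im (w x))) = 0" for b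
    proof -
      have "(LINT x|lborel. cis (b * x) * of_real (Im (w x))) =
          (LINT x|lborel. (- \<i> / 2) * (cis (b * x) * w x - cis (b * x) * cnj (w x)))"
        by (intro Bochner_Integration.integral_cong refl) (simp add: complex_eq_iff field_simps)
      also have "\<dots> = 0"
        by (simp, subst Bochner_Integration.integral_diff)
           (auto intro!: integrable_cis_mult w cw simp: w0 cw0 simp del: complex_integrable_cnj)
      finally show ?thesis .
    qed
  qed (use w in auto)
  from re im show ?thesis
    by eventually_elim (simp add: w_def complex_eq_iff)
qed

section \<open>A maximum principle for the Caputo derivative\<close>

text \<open>For \<open>\<nu> < 1\<close> let \<open>Y s = Re (f s) - Re (f t) \<ge> 0\<close> on \<open>(0, t)\<close>. The integrand
  \<open>(t - s)\<^bsup>-\<nu>\<^esup> Y' s\<close> is at most the derivative of \<open>G s = (t - s)\<^bsup>-\<nu>\<^esup> Y s\<close>, since differentiating the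
  singular factor contributes a nonnegative term. So its integral over \<open>[a, b]\<close> is at most \<open>G b\<close>, and
  \<open>G b\<close> tends to \<open>0\<close> as \<open>b \<rightarrow> t\<close>, because \<open>Y\<close> is differentiable at \<open>t\<close> with \<open>Y t = 0\<close>
  and \<open>\<nu> < 1\<close>.\<close>

lemma caputo_nonpos_at_min:
  fixes f :: "real \<Rightarrow> complex"
  assumes \<nu>: "0 < \<nu>" "\<nu> \<le> 1" and t: "0 < t"
    and cd: "caputo_differentiable \<nu> f t" and diff: "f differentiable (at t)"
    and min: "\<And>s. 0 < s \<Longrightarrow> s < t \<Longrightarrow> Re (f t) \<le> Re (f s)"
  shows "Re (caputo_deriv \<nu> f t) \<le> 0"
proof -
  have der_Re: "((\<lambda>s. Re (f s)) has_real_derivative Re (vector_derivative f (at s))) (at s)"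
    if "f differentiable (at s)" for s
    using bounded_linear.has_vector_derivative[OF bounded_linear_Re]
      vector_derivative_works[THEN iffD1, OF that]
    by (auto simp: has_real_derivative_iff_has_vector_derivative)
  show ?thesis
  proof (cases "\<nu> = 1")
    case True
    show ?thesis
    proof (rule ccontr)
      assume "\<not> ?thesis"
      then have "0 < Re (vector_derivative f (at t))" by (simp add: caputo_deriv_def True)
      from DERIV_pos_inc_left[OF der_Re[OF diff] this]
      obtain d where d: "d > 0" "\<And>h. 0 < h \<Longrightarrow> h < d \<Longrightarrow> Re (f (t - h)) < Re (f t)" by auto
      define h where "h = min d t / 2"
      have "0 < h" "h < d" "h < t" using d(1) t by (auto simp: h_def)
      then show False using d(2)[of h] min[of "t - h"] by simp
    qed
  next
    case False
    then have \<nu>1: "\<nu> < 1" using \<nu> by simp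
    define Y where "Y s = Re (f s) - Re (f t)" for s
    define I where "I s = (t - s) powr (-\<nu>) * Re (vector_derivative f (at s))" for s
    define J where "J s = (t - s) powr (-\<nu>) *\<^sub>R vector_derivative f (at s)" for s
    have J: "set_integrable lborel {0<..<t} J" and df: "\<And>s. 0 < s \<Longrightarrow> s < t \<Longrightarrow> f differentiable (at s)"
      using cd False by (auto simp: caputo_differentiable_def J_def[abs_def])
    have I: "set_integrable lborel {0<..<t} I"
    proof -
      have "integrable lborel (\<lambda>s. Re (indicator {0<..<t} s *\<^sub>R J s))"
        using J unfolding set_integrable_def by (rule integrable_Re)
      then show ?thesis by (simp add: set_integrable_def I_def J_def mult.assoc)
    qed
    have ReJ: "Re (LINT s:{0<..<t}|lborel. J s) = (LINT s:{0<..<t}|lborel. I s)"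
    proof -
      have "Re (LINT s|lborel. indicator {0<..<t} s *\<^sub>R J s) = (LINT s|lborel. Re (indicator {0<..<t} s *\<^sub>R J s))"
        using J unfolding set_integrable_def by (rule integral_Re[symmetric])
      then show ?thesis by (simp add: set_lebesgue_integral_def I_def J_def mult.assoc)
    qed
    have Y0: "0 \<le> Y s" if "0 < s" "s < t" for s using min[of s] that by (simp add: Y_def)
    define G where "G s = (t - s) powr (-\<nu>) * Y s" for s
    have le: "(LINT s:{a..b}|lborel. I s) \<le> G b" if ab: "0 < a" "a \<le> b" "b < t" for a b
    proof -
      have Iab: "set_integrable lborel {a..b} I"
        by (rule set_integrable_subset[OF I]) (use ab in auto)
      let ?g = "\<lambda>s. I s + \<nu> * (t - s) powr (-\<nu> - 1) * Y s"
      have G': "(?g has_integral (G b - G a)) {a..b}"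
      proof (rule fundamental_theorem_of_calculus[OF ab(2)])
        fix s assume s: "s \<in> {a..b}"
        then have s': "0 < s" "s < t" using ab by auto
        have Y': "(Y has_real_derivative Re (vector_derivative f (at s))) (at s)"
          using DERIV_diff[OF der_Re[OF df[OF s']] DERIV_const] by (simp add: Y_def[abs_def])
        have "(G has_real_derivative ?g s) (at s)"
          unfolding G_def I_def using s'
          by (auto intro!: derivative_eq_intros Y' simp: algebra_simps)
        then show "(G has_vector_derivative ?g s) (at s within {a..b})"
          by (auto simp: has_real_derivative_iff_has_vector_derivative intro: has_vector_derivative_at_within)
      qed
      have "(I has_integral (LINT s:{a..b}|lborel. I s)) {a..b}"
        using set_borel_integral_eq_integral[OF Iab] by (simp add: integrable_integral)
      from this G' have le: "(LINT s:{a..b}|lborel. I s) \<le> G b - G a"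
        by (rule has_integral_le) (use ab Y0 \<nu> in auto)
      have "G a \<ge> 0" unfolding G_def using Y0[of a] ab by simp
      with le show ?thesis by linarith
    qed
    define a b where "a n = t / real (n + 2)" and "b n = t - a n" for n
    have a0: "a \<longlonglongrightarrow> 0"
      unfolding a_def by (rule LIMSEQ_ignore_initial_segment[OF lim_const_over_n])
    have ab: "0 < a n" "a n \<le> b n" "b n < t" for n
      using t by (auto simp: a_def b_def field_simps)
    have "(\<lambda>n. LINT s|lborel. indicator {a n..b n} s *\<^sub>R I s) \<longlonglongrightarrow> (LINT s|lborel. indicator {0<..<t} s *\<^sub>R I s)"
    proof (rule integral_dominated_convergence[where w = "\<lambda>s. norm (indicator {0<..<t} s *\<^sub>R I s)"])
      show "AE s in lborel. (\<lambda>n. indicator {a n..b n} s *\<^sub>R I s) \<longlonglongrightarrow> indicator {0<..<t} s *\<^sub>R I s"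
      proof (rule AE_I2)
        fix s
        have "eventually (\<lambda>n. indicator {a n..b n} s = (indicator {0<..<t} s :: real)) sequentially"
        proof (cases "0 < s \<and> s < t")
          case True
          then have "eventually (\<lambda>n. a n < min s (t - s)) sequentially"
            by (intro order_tendstoD(2)[OF a0]) auto
          then show ?thesis by eventually_elim (use True in \<open>auto simp: indicator_def b_def\<close>)
        next
          case False
          then have "indicator {a n..b n} s = (indicator {0<..<t} s :: real)" for n
            using ab[of n] by (auto simp: indicator_def)
          then show ?thesis by simp
        qed
        then show "(\<lambda>n. indicator {a n..b n} s *\<^sub>R I s) \<longlonglongrightarrow> indicator {0<..<t} s *\<^sub>R I s"
          by (intro tendsto_intros tendsto_eventually)
      qed
      show "AE s in lborel. norm (indicator {a n..b n} s *\<^sub>R I s) \<le> norm (indicator {0<..<t} s *\<^sub>R I s)" for n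
        using ab[of n] by (auto simp: indicator_def)
      show "integrable lborel (\<lambda>s. norm (indicator {0<..<t} s *\<^sub>R I s))"
        using I unfolding set_integrable_def by (rule integrable_norm)
      show "(\<lambda>s. indicator {0<..<t} s *\<^sub>R I s) \<in> borel_measurable lborel"
        using I unfolding set_integrable_def by (rule borel_measurable_integrable)
      show "(\<lambda>s. indicator {a n..b n} s *\<^sub>R I s) \<in> borel_measurable lborel" for n
      proof -
        have "set_integrable lborel {a n..b n} I"
          by (rule set_integrable_subset[OF I]) (use ab[of n] in auto)
        then show ?thesis unfolding set_integrable_def by (rule borel_measurable_integrable)
      qed
    qed
    then have lim: "(\<lambda>n. LINT s:{a n..b n}|lborel. I s) \<longlonglongrightarrow> (LINT s:{0<..<t}|lborel. I s)"
      by (simp add: set_lebesgue_integral_def)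
    have "(\<lambda>n. G (b n)) \<longlonglongrightarrow> 0"
    proof -
      have q: "((\<lambda>h. (Re (f (t + h)) - Re (f t)) / h) \<longlongrightarrow> Re (vector_derivative f (at t))) (at 0)"
        using der_Re[OF diff] by (simp add: DERIV_def)
      have "filterlim (\<lambda>n. - a n) (at 0) sequentially"
        using ab(1) by (auto simp: filterlim_at intro!: tendsto_eq_intros a0 always_eventually) (metis less_irrefl)
      from filterlim_compose[OF q this]
      have qq: "(\<lambda>n. Y (b n) / (- a n)) \<longlonglongrightarrow> Re (vector_derivative f (at t))"
        by (simp add: Y_def b_def)
      have pw: "(\<lambda>n. a n powr (1 - \<nu>)) \<longlonglongrightarrow> 0"
        using \<nu>1 by (intro tendsto_zero_powrI[OF a0 tendsto_const]) (auto simp: ab(1) less_imp_le)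
      have "(\<lambda>n. a n powr (1 - \<nu>) * - (Y (b n) / (- a n))) \<longlonglongrightarrow> 0"
        using tendsto_mult[OF pw tendsto_minus[OF qq]] by (simp only: mult_zero_left)
      also have "(\<lambda>n. a n powr (1 - \<nu>) * - (Y (b n) / (- a n))) = (\<lambda>n. G (b n))"
      proof
        fix n show "a n powr (1 - \<nu>) * - (Y (b n) / (- a n)) = G (b n)"
          using ab(1)[of n] by (simp add: G_def b_def powr_diff powr_minus field_simps)
      qed
      finally show ?thesis .
    qed
    from LIMSEQ_le[OF lim this] le ab have "(LINT s:{0<..<t}|lborel. I s) \<le> 0" by blast
    moreover have "Gamma (1 - \<nu>) > 0" using \<nu>1 by (intro Gamma_real_pos) auto
    ultimately show ?thesis
      using False ReJ unfolding caputo_deriv_def J_def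
      by (auto simp: mult_le_0_iff divide_le_0_iff)
  qed
qed

text \<open>A negative value would give a negative minimum at some positive time, where
  \<open>caputo_nonpos_at_min\<close> contradicts the hypothesis on the sign of the derivative.\<close>

lemma caputo_comparison:
  fixes f :: "real \<Rightarrow> complex"
  assumes \<nu>: "0 < \<nu>" "\<nu> \<le> 1"
    and cont: "continuous_on {0..} f" and init: "0 \<le> Re (f 0)"
    and cd: "\<And>t. 0 < t \<Longrightarrow> caputo_differentiable \<nu> f t"
    and pos: "\<And>t. 0 < t \<Longrightarrow> Re (f t) < 0 \<Longrightarrow> 0 < Re (caputo_deriv \<nu> f t)"
    and t: "0 \<le> t"
  shows "0 \<le> Re (f t)"
proof (rule ccontr)
  assume neg: "\<not> 0 \<le> Re (f t)"
  have "continuous_on {0..t} (\<lambda>s. Re (f s))"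
    by (intro continuous_intros continuous_on_subset[OF cont]) auto
  then obtain m where m: "m \<in> {0..t}" "\<And>s. s \<in> {0..t} \<Longrightarrow> Re (f m) \<le> Re (f s)"
    using continuous_attains_inf[of "{0..t}" "\<lambda>s. Re (f s)"] t by auto
  have fm: "Re (f m) < 0" using m(2)[of t] neg t by auto
  then have m0: "0 < m" using init m(1) by (cases "m = 0") auto
  have "f differentiable (at m)"
    using cd[of m] cd[of "m + 1"] m0 by (auto simp: caputo_differentiable_def split: if_splits)
  then have "Re (caputo_deriv \<nu> f m) \<le> 0"
    using m m0 by (intro caputo_nonpos_at_min \<nu> cd) auto
  then show False using pos[OF m0 fm] by simp
qed

lemma caputo_linear:
  assumes f: "caputo_differentiable \<nu> f t" and g: "caputo_differentiable \<nu> g t"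
  shows "caputo_differentiable \<nu> (\<lambda>s. a * f s + g s) t"
    and "caputo_deriv \<nu> (\<lambda>s. a * f s + g s) t = a * caputo_deriv \<nu> f t + caputo_deriv \<nu> g t"
proof -
  have d: "(\<lambda>s. a * f s + g s) differentiable (at s)"
    "vector_derivative (\<lambda>s. a * f s + g s) (at s) = a * vector_derivative f (at s) + vector_derivative g (at s)"
    if "f differentiable (at s)" "g differentiable (at s)" for s
    using that by (auto intro!: derivative_intros)
  show "caputo_differentiable \<nu> (\<lambda>s. a * f s + g s) t"
    "caputo_deriv \<nu> (\<lambda>s. a * f s + g s) t = a * caputo_deriv \<nu> f t + caputo_deriv \<nu> g t"
  proof -
    show "caputo_differentiable \<nu> (\<lambda>s. a * f s + g s) t"
    proof (cases "\<nu> = 1")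
      case False
      let ?I = "\<lambda>f s. (t - s) powr (-\<nu>) *\<^sub>R vector_derivative f (at s)"
      have If: "set_integrable lborel {0<..<t} (?I f)" and Ig: "set_integrable lborel {0<..<t} (?I g)"
        using f g False by (auto simp: caputo_differentiable_def)
      have "set_integrable lborel {0<..<t} (\<lambda>s. a * ?I f s + ?I g s)"
        by (intro set_integral_add(1) set_integrable_mult_right If Ig)
      also have "?this \<longleftrightarrow> set_integrable lborel {0<..<t} (?I (\<lambda>s. a * f s + g s))"
        using f g False by (intro set_integrable_cong refl)
          (auto simp: caputo_differentiable_def d algebra_simps scaleR_conv_of_real)
      finally show ?thesis
        using f g False by (auto simp: caputo_differentiable_def intro: d)
    qed (use f g in \<open>auto simp: caputo_differentiable_def intro: d\<close>)
    show "caputo_deriv \<nu> (\<lambda>s. a * f s + g s) t = a * caputo_deriv \<nu> f t + caputo_deriv \<nu> g t"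
    proof (cases "\<nu> = 1")
      case False
      let ?I = "\<lambda>f s. (t - s) powr (-\<nu>) *\<^sub>R vector_derivative f (at s)"
      have If: "set_integrable lborel {0<..<t} (?I f)" and Ig: "set_integrable lborel {0<..<t} (?I g)"
        using f g False by (auto simp: caputo_differentiable_def)
      have "(LINT s:{0<..<t}|lborel. ?I (\<lambda>s. a * f s + g s) s) = (LINT s:{0<..<t}|lborel. a * ?I f s + ?I g s)"
        using f g False by (intro set_lebesgue_integral_cong)
          (auto simp: caputo_differentiable_def d algebra_simps scaleR_conv_of_real)
      also have "\<dots> = a * (LINT s:{0<..<t}|lborel. ?I f s) + (LINT s:{0<..<t}|lborel. ?I g s)"
        by (simp only: set_integral_add(2)[OF set_integrable_mult_right[OF If] Ig] set_integral_mult_right)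
      finally show ?thesis
        using False by (simp add: caputo_deriv_def scaleR_conv_of_real algebra_simps)
    qed (use f g in \<open>auto simp: caputo_differentiable_def caputo_deriv_def d\<close>)
  qed
qed

section \<open>Power series in a fractional power, integrated against a Beta kernel\<close>

definition power_series :: "(nat \<Rightarrow> real) \<Rightarrow> real \<Rightarrow> real" where
  "power_series a x = (\<Sum>k. a k * x ^ k)"

definition entire_coeffs :: "(nat \<Rightarrow> real) \<Rightarrow> bool" where
  "entire_coeffs a \<longleftrightarrow> (\<forall>x. summable (\<lambda>k. a k * x ^ k))"

lemma entire_coeffs_diffs: "entire_coeffs a \<Longrightarrow> entire_coeffs (diffs a)"
  by (auto simp: entire_coeffs_def intro: termdiff_converges_all)

lemma power_series_deriv:
  "entire_coeffs a \<Longrightarrow> (power_series a has_real_derivative power_series (diffs a) x) (at x)"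
  unfolding power_series_def[abs_def] entire_coeffs_def
  by (rule termdiffs_strong_converges_everywhere) auto

lemma power_series_0: "power_series a 0 = a 0"
  unfolding power_series_def by (subst powser_zero) simp

lemma entire_coeffs_abs_summable: "entire_coeffs a \<Longrightarrow> summable (\<lambda>k. \<bar>a k\<bar> * \<bar>x\<bar> ^ k)"
  using powser_insidea[of a "\<bar>x\<bar> + 1" x] by (auto simp: entire_coeffs_def abs_mult power_abs)

lemma continuous_on_power_series: "entire_coeffs a \<Longrightarrow> continuous_on S (power_series a)"
  using power_series_deriv by (meson DERIV_continuous_on has_field_derivative_at_within)

lemma continuous_power_series_powr:
  assumes "entire_coeffs a" "0 < \<gamma>"
  shows "continuous_on {0..} (\<lambda>t. power_series a (t powr \<gamma>))"
  by (rule continuous_on_compose2[OF continuous_on_power_series[OF assms(1), of UNIV]])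
     (use assms(2) in \<open>auto intro!: continuous_intros continuous_on_powr'\<close>)

lemma power_series_add:
  "entire_coeffs a \<Longrightarrow> entire_coeffs b \<Longrightarrow> power_series (\<lambda>k. a k + b k) x = power_series a x + power_series b x"
  by (simp add: power_series_def entire_coeffs_def distrib_right suminf_add)

lemma power_series_uminus:
  "entire_coeffs a \<Longrightarrow> power_series (\<lambda>k. - a k) x = - power_series a x"
  by (simp add: power_series_def entire_coeffs_def suminf_minus)

lemma power_series_cmult:
  "entire_coeffs a \<Longrightarrow> power_series (\<lambda>k. r * a k) x = r * power_series a x"
  by (simp add: power_series_def entire_coeffs_def mult.assoc suminf_mult)

lemma entire_coeffs_cmult: "entire_coeffs a \<Longrightarrow> entire_coeffs (\<lambda>k. r * a k)"
  by (simp add: entire_coeffs_def mult.assoc summable_mult)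

lemma power_series_scale: "power_series (\<lambda>k. z ^ k * a k) x = power_series a (z * x)"
  by (simp add: power_series_def power_mult_distrib mult_ac)

lemma entire_coeffs_scale: "entire_coeffs a \<Longrightarrow> entire_coeffs (\<lambda>k. z ^ k * a k)"
  unfolding entire_coeffs_def
proof
  fix x assume "\<forall>x. summable (\<lambda>k. a k * x ^ k)"
  then have "summable (\<lambda>k. a k * (z * x) ^ k)" by blast
  then show "summable (\<lambda>k. z ^ k * a k * x ^ k)" by (simp add: power_mult_distrib mult_ac)
qed

lemma entire_coeffs_funpow_diffs: "entire_coeffs a \<Longrightarrow> entire_coeffs ((diffs ^^ n) a)"
  by (induction n) (auto intro: entire_coeffs_diffs)

lemma funpow_diffs: "(diffs ^^ n) a k = fact n * of_nat ((k + n) choose n) * (a (k + n) :: real)"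
proof (induction n arbitrary: k)
  case (Suc n)
  have "Suc n * (Suc (k + n) choose Suc n) = Suc k * (Suc (k + n) choose n)"
    using Suc_times_binomial_add[of n k] by (simp only: add.commute)
  then have "real (Suc n) * real (Suc (k + n) choose Suc n) = real (Suc k) * real (Suc (k + n) choose n)"
    by (metis of_nat_mult)
  moreover have "(diffs ^^ Suc n) a k = real (Suc k) * (diffs ^^ n) a (Suc k)"
    unfolding funpow.simps comp_apply by (subst diffs_def) simp
  ultimately show ?case
    unfolding Suc.IH fact_Suc add_Suc add_Suc_right of_nat_mult by (simp only: mult_ac)
qed auto

text \<open>On the right the terms with \<open>k < n\<close> vanish, and the others are those of the \<open>n\<close>-th derivative after
  a shift of the index. The coefficients are kept in binomial form for the Pascal rule below.\<close>

lemma power_series_funpow_diffs: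
  assumes a: "entire_coeffs (\<lambda>k. a k * real (k choose n))"
  shows "x ^ n * power_series ((diffs ^^ n) a) x = fact n * power_series (\<lambda>k. a k * real (k choose n)) x"
proof -
  let ?b = "\<lambda>k. a k * real (k choose n) * x ^ k"
  have s: "summable ?b" using a by (simp add: entire_coeffs_def)
  have "suminf ?b = (\<Sum>k. ?b (k + n)) + (\<Sum>k<n. ?b k)"
    by (rule suminf_split_initial_segment[OF s])
  also have "(\<Sum>k<n. ?b k) = 0" by (simp add: sum.neutral)
  also have "(\<lambda>k. ?b (k + n)) = (\<lambda>k. x ^ n * (a (k + n) * real ((k + n) choose n) * x ^ k))"
    by (simp add: power_add mult_ac)
  finally have "fact n * power_series (\<lambda>k. a k * real (k choose n)) x =
      (\<Sum>k. fact n * (x ^ n * (a (k + n) * real ((k + n) choose n) * x ^ k)))"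
    using summable_ignore_initial_segment[OF s, of n]
    by (simp add: power_series_def suminf_mult power_add mult_ac)
  moreover have "x ^ n * power_series ((diffs ^^ n) a) x =
      (\<Sum>k. x ^ n * (fact n * (a (k + n) * real ((k + n) choose n) * x ^ k)))"
  proof -
    have "summable (\<lambda>k. (diffs ^^ n) a k * x ^ k)"
    proof (cases "x = 0")
      case True then show ?thesis by (simp only: summable_0_powser)
    next
      case False
      from summable_mult[OF summable_ignore_initial_segment[OF s, of n], of "fact n / x ^ n"] False
      show ?thesis by (simp add: funpow_diffs power_add mult_ac)
    qed
    then show ?thesis
      unfolding power_series_def by (subst suminf_mult[symmetric]) (simp_all add: funpow_diffs mult_ac)
  qed
  ultimately show ?thesis by (simp add: mult_ac)
qed

lemma beta_kernel:
  fixes p q t :: real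
  assumes p: "0 < p" and q: "0 < q" and t: "0 < t"
  shows "set_integrable lborel {0<..<t} (\<lambda>s. (t - s) powr (q - 1) * s powr (p - 1))"
    and "(LINT s:{0<..<t}|lborel. (t - s) powr (q - 1) * s powr (p - 1)) = t powr (p + q - 1) * Beta p q"
proof -
  let ?B = "\<lambda>x::real. x powr (p - 1) * (1 - x) powr (q - 1)"
  have int: "set_integrable lborel {0<..<1} ?B"
    by (rule set_integrable_subset[OF integrable_Beta[OF p q]]) auto
  have "(?B has_integral Beta p q) {0<..<1}"
    using has_integral_Beta_real[OF p q] by (simp add: has_integral_Icc_iff_Ioo)
  then have val: "(LINT x:{0<..<1}|lborel. ?B x) = Beta p q"
    using set_borel_integral_eq_integral[OF int] by (simp add: integral_unique)
  have scale: "indicator {0<..<1} (0 + 1 / t * s) *\<^sub>R ?B (0 + 1 / t * s) =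
      t powr (2 - p - q) * (indicator {0<..<t} s *\<^sub>R ((t - s) powr (q - 1) * s powr (p - 1)))" for s
  proof (cases "0 < s \<and> s < t")
    case True
    have "1 - s / t = (t - s) / t" using t by (simp add: field_simps)
    then have "?B (s / t) = (s powr (p - 1) / t powr (p - 1)) * ((t - s) powr (q - 1) / t powr (q - 1))"
      using True t by (simp add: powr_divide)
    also have "\<dots> = t powr (2 - p - q) * ((t - s) powr (q - 1) * s powr (p - 1))"
      using t by (simp add: powr_diff powr_minus field_simps power2_eq_square flip: powr_add)
    finally show ?thesis using True t by (simp add: indicator_def)
  next
    case False
    then show ?thesis using t by (auto simp: indicator_def field_simps)
  qed
  have "integrable lborel (\<lambda>s. indicator {0<..<1} (0 + 1 / t * s) *\<^sub>R ?B (0 + 1 / t * s))"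
    by (rule lborel_integrable_real_affine) (use int t in \<open>auto simp: set_integrable_def\<close>)
  then have "integrable lborel (\<lambda>s. t powr (2 - p - q) * (indicator {0<..<t} s *\<^sub>R ((t - s) powr (q - 1) * s powr (p - 1))))"
    unfolding scale .
  from integrable_mult_right[OF this, of "1 / t powr (2 - p - q)"]
  show "set_integrable lborel {0<..<t} (\<lambda>s. (t - s) powr (q - 1) * s powr (p - 1))"
    using t by (simp add: set_integrable_def)
  have "Beta p q = \<bar>1 / t\<bar> *\<^sub>R (LINT s|lborel. indicator {0<..<1} (0 + 1 / t * s) *\<^sub>R ?B (0 + 1 / t * s))"
    unfolding val[symmetric] set_lebesgue_integral_def
    by (rule lborel_integral_real_affine) (use t in auto)
  also have "\<dots> = t powr (1 - p - q) * (LINT s:{0<..<t}|lborel. (t - s) powr (q - 1) * s powr (p - 1))"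
  proof -
    have "t powr (1 - p - q) = t powr (2 - p - q) / t"
      using t by (simp add: powr_diff power2_eq_square)
    then show ?thesis
      unfolding scale set_lebesgue_integral_def integral_mult_right_zero using t by simp
  qed
  finally show "(LINT s:{0<..<t}|lborel. (t - s) powr (q - 1) * s powr (p - 1)) = t powr (p + q - 1) * Beta p q"
    using t by (simp add: powr_diff powr_add field_simps)
qed

text \<open>Termwise integration is justified because \<open>s powr \<gamma> \<le> t powr \<gamma>\<close> on \<open>(0, t)\<close>, so the integrals
  of the absolute values of the terms are dominated by the absolutely convergent series at \<open>t powr \<gamma>\<close>.
  The value is stated as a series that \<open>sums\<close>, so that later rearrangements need no
  separate convergence argument.\<close>

lemma beta_kernel_power_series:
  fixes p q \<gamma> t :: real
  assumes p: "0 < p" and q: "0 < q" and g: "0 < \<gamma>" and t: "0 < t" and a: "entire_coeffs a"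
  shows "set_integrable lborel {0<..<t} (\<lambda>s. (t - s) powr (q - 1) * s powr (p - 1) * power_series a (s powr \<gamma>))"
    and "(\<lambda>k. a k * Beta (p + \<gamma> * k) q * (t powr \<gamma>) ^ k) sums
      ((LINT s:{0<..<t}|lborel. (t - s) powr (q - 1) * s powr (p - 1) * power_series a (s powr \<gamma>)) / t powr (p + q - 1))"
proof -
  let ?w = "\<lambda>s. (t - s) powr (q - 1) * s powr (p - 1)"
  define f where "f k s = indicator {0<..<t} s *\<^sub>R (?w s * (a k * (s powr \<gamma>) ^ k))" for k s
  have f_alt: "f k s = a k * (indicator {0<..<t} s *\<^sub>R ((t - s) powr (q - 1) * s powr (p + \<gamma> * k - 1)))" for k s
  proof (cases "0 < s \<and> s < t")
    case True
    then have "s powr (p - 1) * (s powr \<gamma>) ^ k = s powr (p + \<gamma> * k - 1)"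
      by (simp add: powr_realpow[symmetric] powr_powr flip: powr_add) (simp add: algebra_simps)
    then show ?thesis using True by (simp add: f_def mult_ac)
  qed (auto simp: f_def indicator_def)
  have pk: "0 < p + \<gamma> * real k" for k using p g by (simp add: add_pos_nonneg)
  have f_int: "integrable lborel (f k)" for k
    unfolding f_alt[abs_def] using beta_kernel(1)[OF pk q t]
    by (intro integrable_mult_right) (simp add: set_integrable_def)
  have f_val: "integral\<^sup>L lborel (f k) = t powr (p + q - 1) * (a k * Beta (p + \<gamma> * k) q * (t powr \<gamma>) ^ k)" for k
  proof -
    have "integral\<^sup>L lborel (f k) = a k * (t powr (p + \<gamma> * k + q - 1) * Beta (p + \<gamma> * k) q)"
      unfolding f_alt[abs_def] using beta_kernel(2)[OF pk[of k] q t] by (simp add: set_lebesgue_integral_def)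
    moreover have "t powr (p + \<gamma> * k + q - 1) = t powr (p + q - 1) * (t powr \<gamma>) ^ k"
      using t by (simp add: powr_realpow[symmetric] powr_powr flip: powr_add) (simp add: algebra_simps)
    ultimately show ?thesis by simp
  qed
  have w: "integrable lborel (\<lambda>s. indicator {0<..<t} s *\<^sub>R ?w s)"
    using beta_kernel(1)[OF p q t] by (simp add: set_integrable_def)
  have sums_abs: "summable (\<lambda>k. \<bar>a k\<bar> * \<bar>x\<bar> ^ k)" for x
    by (rule entire_coeffs_abs_summable[OF a])
  have sum1: "AE s in lborel. summable (\<lambda>k. norm (f k s))"
  proof (rule AE_I2)
    fix s
    have "summable (\<lambda>k. (indicator {0<..<t} s * ?w s) * (\<bar>a k\<bar> * \<bar>s powr \<gamma>\<bar> ^ k))"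
      by (rule summable_mult[OF sums_abs])
    then show "summable (\<lambda>k. norm (f k s))"
      by (simp add: f_def abs_mult mult_ac power_abs)
  qed
  have sum2: "summable (\<lambda>k. LINT s|lborel. norm (f k s))"
  proof (rule summable_comparison_test'[where N = 0])
    show "summable (\<lambda>k. (LINT s|lborel. indicator {0<..<t} s *\<^sub>R ?w s) * (\<bar>a k\<bar> * \<bar>t powr \<gamma>\<bar> ^ k))"
      by (rule summable_mult[OF sums_abs])
    fix k :: nat
    have "(LINT s|lborel. norm (f k s)) \<le> (LINT s|lborel. (indicator {0<..<t} s *\<^sub>R ?w s) * (\<bar>a k\<bar> * \<bar>t powr \<gamma>\<bar> ^ k))"
    proof (rule integral_mono)
      fix s
      show "norm (f k s) \<le> (indicator {0<..<t} s *\<^sub>R ?w s) * (\<bar>a k\<bar> * \<bar>t powr \<gamma>\<bar> ^ k)"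
        using t g by (auto simp: f_def indicator_def abs_mult power_abs
          intro!: mult_left_mono power_mono powr_mono2)
    qed (use f_int w in auto)
    then show "norm (LINT s|lborel. norm (f k s)) \<le> (LINT s|lborel. indicator {0<..<t} s *\<^sub>R ?w s) * (\<bar>a k\<bar> * \<bar>t powr \<gamma>\<bar> ^ k)"
      by simp
  qed
  have suminf: "(\<Sum>k. f k s) = indicator {0<..<t} s *\<^sub>R (?w s * power_series a (s powr \<gamma>))" for s
    using a by (simp add: f_def power_series_def entire_coeffs_def suminf_mult mult.assoc)
  from integrable_suminf[OF f_int sum1 sum2]
  show "set_integrable lborel {0<..<t} (\<lambda>s. ?w s * power_series a (s powr \<gamma>))"
    by (simp add: suminf set_integrable_def)
  from sums_integral[OF f_int sum1 sum2]
  have "(\<lambda>k. t powr (p + q - 1) * (a k * Beta (p + \<gamma> * k) q * (t powr \<gamma>) ^ k)) sums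
      (LINT s:{0<..<t}|lborel. ?w s * power_series a (s powr \<gamma>))"
    by (simp add: suminf f_val set_lebesgue_integral_def)
  from sums_divide[OF this, of "t powr (p + q - 1)"]
  show "(\<lambda>k. a k * Beta (p + \<gamma> * k) q * (t powr \<gamma>) ^ k) sums
      ((LINT s:{0<..<t}|lborel. ?w s * power_series a (s powr \<gamma>)) / t powr (p + q - 1))"
    using t by simp
qed

section \<open>The Kilbas--Saigo coefficients\<close>

text \<open>The factor by which the Riemann--Liouville integral of order \<open>\<nu>\<close> multiplies the power with
  exponent \<open>\<gamma> (k + 1) - \<nu>\<close>.\<close>

definition gamma_ratio :: "real \<Rightarrow> real \<Rightarrow> nat \<Rightarrow> real" where
  "gamma_ratio \<nu> \<gamma> k = Gamma (\<gamma> * real (Suc k) + 1 - \<nu>) / Gamma (\<gamma> * real (Suc k) + 1)"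

definition ks_coeff :: "real \<Rightarrow> real \<Rightarrow> nat \<Rightarrow> real" where
  "ks_coeff \<nu> \<gamma> k = (\<Prod>j<k. gamma_ratio \<nu> \<gamma> j)"

text \<open>Here \<open>\<gamma>\<close> stands for \<open>\<nu> + 2H - 1\<close>. In these terms \<open>2H = \<gamma> + 1 - \<nu>\<close>, so that every argument of the
  Gamma function below is positive.\<close>

locale kilbas_saigo_params =
  fixes \<nu> \<gamma> :: real
  assumes nu: "0 < \<nu>" "\<nu> \<le> 1" and gam: "0 < \<gamma>"
begin

abbreviation "\<rho> \<equiv> gamma_ratio \<nu> \<gamma>"
abbreviation "c \<equiv> ks_coeff \<nu> \<gamma>"

lemma arg_pos: "0 < \<gamma> * real (Suc k)"
  using gam by simp

lemma ratio_pos: "0 < \<rho> k"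
  using arg_pos[of k] nu by (auto simp: gamma_ratio_def intro!: divide_pos_pos Gamma_real_pos)

lemma ratio_eq_Beta: "\<rho> k = Beta (\<gamma> + 1 - \<nu> + \<gamma> * k) \<nu> / Gamma \<nu>"
proof -
  have "Gamma \<nu> > 0" using nu by (intro Gamma_real_pos) auto
  then show ?thesis
    by (simp add: gamma_ratio_def Beta_def algebra_simps)
qed

text \<open>With \<open>s = \<gamma> (k + 1)\<close>, the point \<open>s + 1 - \<nu>\<close> lies between \<open>s\<close> and \<open>s + 1\<close>. Logarithmic convexity of
  the Gamma function gives \<open>\<Gamma>(s + 1 - \<nu>) \<le> \<Gamma>(s)\<^sup>\<nu> \<Gamma>(s + 1)\<^bsup>1-\<nu>\<^esup>\<close>, and
  \<open>\<Gamma>(s) / \<Gamma>(s + 1) = 1 / s\<close>.\<close>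

lemma ratio_le: "\<rho> k \<le> (\<gamma> * real (Suc k)) powr (-\<nu>)"
proof -
  define s where "s = \<gamma> * real (Suc k)"
  have s: "0 < s" unfolding s_def by (rule arg_pos)
  have G: "0 < Gamma s" "0 < Gamma (s + 1)" "0 < Gamma (s + 1 - \<nu>)"
    using s nu by (auto intro!: Gamma_real_pos)
  have "ln (Gamma ((1 - (1 - \<nu>)) *\<^sub>R s + (1 - \<nu>) *\<^sub>R (s + 1))) \<le> (1 - (1 - \<nu>)) * ln (Gamma s) + (1 - \<nu>) * ln (Gamma (s + 1))"
    using convex_onD[OF log_convex_Gamma_real, of "1 - \<nu>" s "s + 1"] s nu by simp
  moreover have "(1 - (1 - \<nu>)) *\<^sub>R s + (1 - \<nu>) *\<^sub>R (s + 1) = s + 1 - \<nu>"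
    by (simp add: algebra_simps)
  ultimately have "ln (Gamma (s + 1 - \<nu>)) - ln (Gamma (s + 1)) \<le> \<nu> * (ln (Gamma s) - ln (Gamma (s + 1)))"
    by (simp add: algebra_simps)
  also have "ln (Gamma s) - ln (Gamma (s + 1)) = - ln s"
  proof -
    have "Gamma (s + 1) = s * Gamma s"
      using s by (intro Gamma_plus1) (auto dest: nonpos_Ints_nonpos)
    then show ?thesis using ln_mult_pos[OF s G(1)] by simp
  qed
  finally have "ln (Gamma (s + 1 - \<nu>) / Gamma (s + 1)) \<le> - \<nu> * ln s"
    using G by (simp add: ln_div)
  then have "Gamma (s + 1 - \<nu>) / Gamma (s + 1) \<le> exp (- \<nu> * ln s)"
    using G by (metis divide_pos_pos exp_le_cancel_iff exp_ln)
  then show ?thesis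
    using s unfolding gamma_ratio_def s_def[symmetric] by (simp add: powr_def)
qed

lemma ratio_tendsto_0: "\<rho> \<longlonglongrightarrow> 0"
proof (rule tendsto_sandwich[where f = "\<lambda>_. 0" and h = "\<lambda>k. (\<gamma> * real (Suc k)) powr (-\<nu>)"])
  have "filterlim (\<lambda>k. \<gamma> * real (Suc k)) at_top sequentially"
    by (rule filterlim_tendsto_pos_mult_at_top[OF tendsto_const gam
          filterlim_compose[OF filterlim_real_sequentially filterlim_Suc]])
  then show "(\<lambda>k. (\<gamma> * real (Suc k)) powr (-\<nu>)) \<longlonglongrightarrow> 0"
    using nu by (intro tendsto_neg_powr) auto
qed (auto intro!: always_eventually less_imp_le[OF ratio_pos] ratio_le simp del: of_nat_Suc)

lemma coeff_pos: "0 < c k"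
  unfolding ks_coeff_def by (intro prod_pos) (simp add: ratio_pos)

lemma coeff_0: "c 0 = 1" and coeff_Suc: "c (Suc k) = c k * \<rho> k"
  by (simp_all add: ks_coeff_def)

lemma entire_coeff: "entire_coeffs c"
  unfolding entire_coeffs_def
proof
  fix x :: real
  have "(\<lambda>k. \<bar>x\<bar> * \<rho> k) \<longlonglongrightarrow> 0"
    using tendsto_mult[OF tendsto_const ratio_tendsto_0] by simp
  then have "eventually (\<lambda>k. \<bar>x\<bar> * \<rho> k < 1 / 2) sequentially"
    by (rule order_tendstoD) simp
  then obtain N where N: "\<And>k. N \<le> k \<Longrightarrow> \<bar>x\<bar> * \<rho> k < 1 / 2"
    by (auto simp: eventually_sequentially)
  show "summable (\<lambda>k. c k * x ^ k)"
  proof (rule summable_ratio_test[where c = "1 / 2" and N = N])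
    fix k assume "N \<le> k"
    then have "\<bar>x\<bar> * \<rho> k * (c k * \<bar>x\<bar> ^ k) \<le> 1 / 2 * (c k * \<bar>x\<bar> ^ k)"
      using coeff_pos[of k] by (intro mult_right_mono less_imp_le[OF N]) auto
    then show "norm (c (Suc k) * x ^ Suc k) \<le> 1 / 2 * norm (c k * x ^ k)"
      using coeff_pos[of k] ratio_pos[of k] by (simp add: coeff_Suc abs_mult power_abs mult_ac)
  qed simp
qed

text \<open>Since \<open>k choose n \<le> 2\<^sup>k\<close>, the binomial factor is absorbed by doubling the argument.\<close>

lemma entire_binomial_coeff: "entire_coeffs (\<lambda>k. z ^ k * c k * real (k choose n))"
  unfolding entire_coeffs_def
proof
  fix x :: real
  have "summable (\<lambda>k. c k * (\<bar>2 * z * x\<bar>) ^ k)"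
    using entire_coeff by (simp add: entire_coeffs_def)
  then show "summable (\<lambda>k. z ^ k * c k * real (k choose n) * x ^ k)"
  proof (rule summable_comparison_test'[where N = 0])
    fix k :: nat
    have "k choose n \<le> 2 ^ k"
      by (cases "n \<le> k") (auto simp: binomial_le_pow2)
    then have "real (k choose n) \<le> 2 ^ k" using of_nat_mono by fastforce
    then have "real (k choose n) * (c k * \<bar>z * x\<bar> ^ k) \<le> 2 ^ k * (c k * \<bar>z * x\<bar> ^ k)"
      using coeff_pos[of k] by (intro mult_right_mono) auto
    then show "norm (z ^ k * c k * real (k choose n) * x ^ k) \<le> c k * \<bar>2 * z * x\<bar> ^ k"
      using coeff_pos[of k] by (simp add: abs_mult power_abs power_mult_distrib mult_ac)
  qed
qed

lemma kilbas_saigo_eq: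
  assumes l: "l = (\<gamma> - \<nu>) / \<nu>" and m: "m = 1 + l"
  shows "kilbas_saigo \<nu> m l (complex_of_real z) = of_real (power_series c z)"
proof -
  have ratio: "Gamma (\<nu> * (real j * m + l) + 1) / Gamma (\<nu> * (real j * m + l + 1) + 1) = \<rho> j" for j
  proof -
    have "\<nu> * l = \<gamma> - \<nu>" "\<nu> * m = \<gamma>" using nu by (simp_all add: l m field_simps)
    moreover have "\<nu> * (real j * m + l) = real j * (\<nu> * m) + \<nu> * l"
      "\<nu> * (real j * m + l + 1) = real j * (\<nu> * m) + \<nu> * l + \<nu>"
      by (simp_all add: algebra_simps)
    ultimately have "\<nu> * (real j * m + l) + 1 = \<gamma> * real (Suc j) + 1 - \<nu>"
      "\<nu> * (real j * m + l + 1) + 1 = \<gamma> * real (Suc j) + 1"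
      by (simp_all add: distrib_left mult.commute[of \<gamma>])
    then show ?thesis by (simp only: gamma_ratio_def)
  qed
  have s: "summable (\<lambda>k. c k * z ^ k)" using entire_coeff by (simp add: entire_coeffs_def)
  have s': "summable (\<lambda>k. c (Suc k) * z ^ Suc k)"
    by (rule summable_Suc_iff[THEN iffD2, OF s])
  have "kilbas_saigo \<nu> m l (complex_of_real z) = 1 + (\<Sum>k. complex_of_real (c (Suc k) * z ^ Suc k))"
    unfolding kilbas_saigo_def Let_def ratio ks_coeff_def by simp
  also have "\<dots> = of_real (1 + (\<Sum>k. c (Suc k) * z ^ Suc k))"
    by (simp only: of_real_add of_real_1 suminf_of_real[OF s'])
  also have "1 + (\<Sum>k. c (Suc k) * z ^ Suc k) = power_series c z"
    unfolding power_series_def using suminf_split_head[OF s] by (simp add: coeff_0)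
  finally show ?thesis .
qed

section \<open>Fractional differential equations solved by power series\<close>

lemma vector_derivative_power_series_powr:
  assumes a: "entire_coeffs a" and s: "0 < s"
  shows "((\<lambda>s. complex_of_real (power_series a (s powr \<gamma>))) has_vector_derivative
    of_real (\<gamma> * s powr (\<gamma> - 1) * power_series (diffs a) (s powr \<gamma>))) (at s)"
proof -
  have "((\<lambda>s. s powr \<gamma>) has_real_derivative \<gamma> * s powr (\<gamma> - 1)) (at s)"
    using s by (auto intro!: derivative_eq_intros)
  from DERIV_chain2[OF power_series_deriv[OF a] this]
  have "((\<lambda>s. power_series a (s powr \<gamma>)) has_real_derivative
      \<gamma> * s powr (\<gamma> - 1) * power_series (diffs a) (s powr \<gamma>)) (at s)"
    by (simp add: mult_ac)
  then show ?thesis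
    by (intro has_vector_derivative_of_real) (simp add: has_real_derivative_iff_has_vector_derivative)
qed

text \<open>On series in \<open>t\<^bsup>\<gamma>\<^esup>\<close> the Caputo derivative is a weighted shift of the coefficients, up to the factor
  \<open>t\<^bsup>\<gamma>-\<nu>\<^esup>\<close>. The case \<open>\<nu> = 1\<close> is ordinary differentiation, with \<open>\<rho> k = 1 / (\<gamma> (k + 1))\<close>; for \<open>\<nu> < 1\<close> the
  derivative \<open>\<gamma> s\<^bsup>\<gamma>-1\<^esup> g'(s\<^bsup>\<gamma>\<^esup>)\<close> of \<open>g(s\<^bsup>\<gamma>\<^esup>)\<close> is integrated against the Beta kernel with
  \<open>p = \<gamma>\<close> and \<open>q = 1 - \<nu>\<close>.\<close>

lemma caputo_power_series_powr:
  assumes a: "entire_coeffs a" and t: "0 < t"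
  shows "caputo_differentiable \<nu> (\<lambda>s. of_real (power_series a (s powr \<gamma>))) t"
    and "caputo_deriv \<nu> (\<lambda>s. of_real (power_series a (s powr \<gamma>))) t =
      of_real (t powr (\<gamma> - \<nu>) * power_series (\<lambda>k. a (Suc k) / \<rho> k) (t powr \<gamma>))"
proof -
  let ?f = "\<lambda>s. complex_of_real (power_series a (s powr \<gamma>))"
  let ?d = "\<lambda>s. \<gamma> * s powr (\<gamma> - 1) * power_series (diffs a) (s powr \<gamma>)"
  have diff: "?f differentiable (at s)" and vd: "vector_derivative ?f (at s) = of_real (?d s)" if "0 < s" for s
    using vector_derivative_power_series_powr[OF a that]
    by (auto intro: differentiableI_vector vector_derivative_at)
  have d: "entire_coeffs (diffs a)" by (rule entire_coeffs_diffs[OF a])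
  show "caputo_differentiable \<nu> ?f t"
  proof (cases "\<nu> = 1")
    case True
    then show ?thesis using diff t by (simp add: caputo_differentiable_def)
  next
    case False
    then have q: "0 < 1 - \<nu>" using nu by simp
    from beta_kernel_power_series(1)[OF gam q gam t d]
    have "set_integrable lborel {0<..<t} (\<lambda>s. \<gamma> * ((t - s) powr (-\<nu>) * s powr (\<gamma> - 1) * power_series (diffs a) (s powr \<gamma>)))"
      by (intro set_integrable_mult_right) simp
    then have "set_integrable lborel {0<..<t} (\<lambda>s. complex_of_real (\<gamma> * ((t - s) powr (-\<nu>) * s powr (\<gamma> - 1) * power_series (diffs a) (s powr \<gamma>))))"
      using integrable_of_real[where 'a = complex, of lborel "\<lambda>s. indicator {0<..<t} s *\<^sub>R (\<gamma> * ((t - s) powr (-\<nu>) * s powr (\<gamma> - 1) * power_series (diffs a) (s powr \<gamma>)))"]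
      unfolding set_integrable_def by (simp only: scaleR_conv_of_real of_real_mult of_real_eq_id id_apply)
    also have "?this \<longleftrightarrow> set_integrable lborel {0<..<t} (\<lambda>s. (t - s) powr (-\<nu>) *\<^sub>R vector_derivative ?f (at s))"
      by (intro set_integrable_cong refl) (auto simp: vd scaleR_conv_of_real)
    finally show ?thesis using False diff by (simp add: caputo_differentiable_def)
  qed
  show "caputo_deriv \<nu> ?f t = of_real (t powr (\<gamma> - \<nu>) * power_series (\<lambda>k. a (Suc k) / \<rho> k) (t powr \<gamma>))"
  proof (cases "\<nu> = 1")
    case True
    have "power_series (\<lambda>k. a (Suc k) / \<rho> k) (t powr \<gamma>) = (\<Sum>k. \<gamma> * (diffs a k * (t powr \<gamma>) ^ k))"
      unfolding power_series_def
    proof (intro suminf_cong)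
      fix k
      have "Gamma (\<gamma> * real (Suc k) + 1) = \<gamma> * real (Suc k) * Gamma (\<gamma> * real (Suc k))"
        using arg_pos[of k] by (intro Gamma_plus1) (auto dest: nonpos_Ints_nonpos)
      moreover have "Gamma (\<gamma> * real (Suc k)) > 0" using arg_pos by (rule Gamma_real_pos)
      ultimately have "1 / \<rho> k = \<gamma> * real (Suc k)"
        using True by (simp add: gamma_ratio_def)
      then have "a (Suc k) / \<rho> k = a (Suc k) * (\<gamma> * real (Suc k))"
        by (metis times_divide_eq_right mult.right_neutral)
      then show "a (Suc k) / \<rho> k * (t powr \<gamma>) ^ k = \<gamma> * (diffs a k * (t powr \<gamma>) ^ k)"
        by (simp only: diffs_def) (simp only: mult_ac)
    qed
    also have "\<dots> = \<gamma> * power_series (diffs a) (t powr \<gamma>)"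
      using d by (simp add: power_series_def suminf_mult entire_coeffs_def)
    finally show ?thesis using True vd[OF t] by (simp add: caputo_deriv_def mult_ac)
  next
    case False
    then have q: "0 < 1 - \<nu>" using nu by simp
    have Gq: "Gamma (1 - \<nu>) > 0" using q by (rule Gamma_real_pos)
    let ?I = "\<lambda>s. (t - s) powr (-\<nu>) * s powr (\<gamma> - 1) * power_series (diffs a) (s powr \<gamma>)"
    have "(\<lambda>k. diffs a k * Beta (\<gamma> + \<gamma> * k) (1 - \<nu>) * (t powr \<gamma>) ^ k) sums
      ((LINT s:{0<..<t}|lborel. ?I s) / t powr (\<gamma> - \<nu>))"
      using beta_kernel_power_series(2)[OF gam q gam t d] by simp
    from sums_mult[OF this, of "\<gamma> / Gamma (1 - \<nu>)"]
    have "(\<lambda>k. a (Suc k) / \<rho> k * (t powr \<gamma>) ^ k) sums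
      (\<gamma> / Gamma (1 - \<nu>) * ((LINT s:{0<..<t}|lborel. ?I s) / t powr (\<gamma> - \<nu>)))"
    proof (rule sums_cong[THEN iffD1, rotated])
      fix k
      have "Gamma (\<gamma> * real (Suc k) + 1) = \<gamma> * real (Suc k) * Gamma (\<gamma> * real (Suc k))"
        using arg_pos[of k] by (intro Gamma_plus1) (auto dest: nonpos_Ints_nonpos)
      then have "1 / \<rho> k = \<gamma> * real (Suc k) * Beta (\<gamma> + \<gamma> * k) (1 - \<nu>) / Gamma (1 - \<nu>)"
      proof -
        have "\<gamma> + \<gamma> * real k = \<gamma> * real (Suc k)" "\<gamma> * real (Suc k) + (1 - \<nu>) = \<gamma> * real (Suc k) + 1 - \<nu>"
          by (simp_all add: algebra_simps)
        then show ?thesis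
          using Gq \<open>Gamma (\<gamma> * real (Suc k) + 1) = \<gamma> * real (Suc k) * Gamma (\<gamma> * real (Suc k))\<close>
          by (simp add: gamma_ratio_def Beta_def add_diff_eq del: of_nat_Suc)
      qed
      moreover have "a (Suc k) / \<rho> k = a (Suc k) * (1 / \<rho> k)" by simp
      ultimately show "\<gamma> / Gamma (1 - \<nu>) * (diffs a k * Beta (\<gamma> + \<gamma> * k) (1 - \<nu>) * (t powr \<gamma>) ^ k) =
          a (Suc k) / \<rho> k * (t powr \<gamma>) ^ k"
        by (simp only: diffs_def) simp
    qed
    then have "power_series (\<lambda>k. a (Suc k) / \<rho> k) (t powr \<gamma>) =
        \<gamma> / Gamma (1 - \<nu>) * ((LINT s:{0<..<t}|lborel. ?I s) / t powr (\<gamma> - \<nu>))"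
      by (simp add: power_series_def sums_iff)
    then have *: "t powr (\<gamma> - \<nu>) * power_series (\<lambda>k. a (Suc k) / \<rho> k) (t powr \<gamma>) =
        1 / Gamma (1 - \<nu>) * (\<gamma> * (LINT s:{0<..<t}|lborel. ?I s))"
      using t by simp
    have "(LINT s:{0<..<t}|lborel. (t - s) powr (-\<nu>) *\<^sub>R vector_derivative ?f (at s)) =
        (LINT s:{0<..<t}|lborel. complex_of_real (\<gamma> * ?I s))"
      by (intro set_lebesgue_integral_cong) (auto simp: vd scaleR_conv_of_real)
    also have "\<dots> = of_real (\<gamma> * (LINT s:{0<..<t}|lborel. ?I s))"
      by (simp only: set_integral_complex_of_real set_integral_mult_right)
    finally show ?thesis
      using False unfolding * by (simp add: caputo_deriv_def scaleR_conv_of_real)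
  qed
qed

text \<open>The coefficients \<open>c\<close> are chosen so that the weighted shift maps \<open>z\<^sup>k c k\<close> to \<open>z\<close> times itself.\<close>

lemma caputo_series_solution:
  assumes t: "0 < t"
  shows "caputo_differentiable \<nu> (\<lambda>s. of_real (power_series c (z * s powr \<gamma>))) t"
    and "caputo_deriv \<nu> (\<lambda>s. of_real (power_series c (z * s powr \<gamma>))) t =
      of_real (z * t powr (\<gamma> - \<nu>) * power_series c (z * t powr \<gamma>))"
proof -
  let ?a = "\<lambda>k. z ^ k * c k"
  have a: "entire_coeffs ?a" by (rule entire_coeffs_scale[OF entire_coeff])
  have shift: "(\<lambda>k. ?a (Suc k) / \<rho> k) = (\<lambda>k. z * ?a k)"
  proof
    fix k show "?a (Suc k) / \<rho> k = z * ?a k"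
      using ratio_pos[of k] by (simp add: coeff_Suc)
  qed
  show "caputo_differentiable \<nu> (\<lambda>s. of_real (power_series c (z * s powr \<gamma>))) t"
    using caputo_power_series_powr(1)[OF a t] by (simp add: power_series_scale)
  show "caputo_deriv \<nu> (\<lambda>s. of_real (power_series c (z * s powr \<gamma>))) t =
      of_real (z * t powr (\<gamma> - \<nu>) * power_series c (z * t powr \<gamma>))"
    using caputo_power_series_powr(2)[OF a t] unfolding shift power_series_cmult[OF a]
    by (simp add: power_series_scale mult_ac)
qed

lemma continuous_series_solution: "continuous_on {0..} (\<lambda>s. power_series c (z * s powr \<gamma>))"
  using continuous_power_series_powr[OF entire_coeffs_scale[OF entire_coeff, of z] gam]
  by (simp add: power_series_scale)

text \<open>Let \<open>W\<close> be the series solution of the equation with the opposite sign, \<open>D\<^sup>\<nu> W = t\<^bsup>\<gamma>-\<nu>\<^esup> W\<close>, which is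
  positive because its coefficients are. For every complex \<open>b\<close> the function \<open>b (U - V) + W\<close> satisfies the
  hypothesis of \<open>caputo_comparison\<close>: where its real part is negative, so is that of
  \<open>b (U - V)\<close>, whose Caputo derivative then has nonnegative real part, and \<open>W\<close> contributes
  a positive term. So \<open>Re (b (U - V)) \<ge> - W\<close> for all \<open>b\<close>, which forces \<open>U = V\<close>. The function \<open>W\<close> makes the
  inequality strict also for \<open>r = 0\<close>.\<close>

lemma caputo_linear_equation_unique:
  fixes U V :: "real \<Rightarrow> complex"
  assumes lam: "0 \<le> r" and UV0: "U 0 = V 0"
    and contU: "continuous_on {0..} U" and contV: "continuous_on {0..} V"
    and cdU: "\<And>t. 0 < t \<Longrightarrow> caputo_differentiable \<nu> U t"
    and cdV: "\<And>t. 0 < t \<Longrightarrow> caputo_differentiable \<nu> V t"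
    and eqU: "\<And>t. 0 < t \<Longrightarrow> caputo_deriv \<nu> U t = - of_real (r * t powr (\<gamma> - \<nu>)) * U t"
    and eqV: "\<And>t. 0 < t \<Longrightarrow> caputo_deriv \<nu> V t = - of_real (r * t powr (\<gamma> - \<nu>)) * V t"
    and t: "0 \<le> t"
  shows "U t = V t"
proof (rule ccontr)
  assume neq: "U t \<noteq> V t"
  define W where "W s = power_series c (1 * s powr \<gamma>)" for s
  have W_pos: "0 < W s" for s
  proof -
    have "summable (\<lambda>k. c k * (s powr \<gamma>) ^ k)" using entire_coeff by (simp add: entire_coeffs_def)
    then show ?thesis unfolding W_def power_series_def
      by (intro suminf_pos2[where i = 0]) (auto simp: coeff_0 intro!: mult_nonneg_nonneg less_imp_le[OF coeff_pos])
  qed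
  \<comment> \<open>chosen to make \<open>Y t = - 1\<close>\<close>
  define b where "b = - of_real (W t + 1) / (U t - V t)"
  define Y where "Y s = b * U s + (- b * V s + of_real (W s))" for s
  have "0 \<le> Re (Y t)"
  proof (rule caputo_comparison[OF nu, where f = Y and t = t])
    show "continuous_on {0..} Y"
      unfolding Y_def W_def by (intro continuous_intros contU contV continuous_on_of_real continuous_series_solution)
    show "0 \<le> Re (Y 0)" using W_pos[of 0] by (simp add: Y_def UV0)
    fix s :: real assume s: "0 < s"
    note VW = caputo_linear[OF cdV[OF s] caputo_series_solution(1)[OF s, of 1], of "- b"]
    note UVW = caputo_linear[OF cdU[OF s] VW(1), of b]
    show "caputo_differentiable \<nu> Y s"
      using UVW(1) unfolding Y_def[abs_def] W_def .
    assume neg: "Re (Y s) < 0"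
    have "caputo_deriv \<nu> Y s = b * (- of_real (r * s powr (\<gamma> - \<nu>)) * U s) +
        (- b * (- of_real (r * s powr (\<gamma> - \<nu>)) * V s) + of_real (1 * s powr (\<gamma> - \<nu>) * W s))"
      using UVW(2) unfolding VW(2) caputo_series_solution(2)[OF s] eqU[OF s] eqV[OF s] Y_def[abs_def] W_def .
    also have "\<dots> = of_real (s powr (\<gamma> - \<nu>)) * (of_real (W s) - of_real r * (b * (U s - V s)))"
      by (simp add: algebra_simps)
    finally have "Re (caputo_deriv \<nu> Y s) = s powr (\<gamma> - \<nu>) * (W s - r * Re (b * (U s - V s)))"
      by simp
    moreover have "Re (b * (U s - V s)) < 0"
      using neg W_pos[of s] by (simp add: Y_def algebra_simps)
    then have "r * Re (b * (U s - V s)) \<le> 0"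
      using lam by (intro mult_nonneg_nonpos) auto
    ultimately show "0 < Re (caputo_deriv \<nu> Y s)"
      using s W_pos[of s] by simp
  qed (rule t)
  moreover have "Y t = - 1"
  proof -
    have "Y t = b * (U t - V t) + of_real (W t)" by (simp add: Y_def algebra_simps)
    also have "b * (U t - V t) = - of_real (W t + 1)" using neq by (simp add: b_def)
    finally show ?thesis by simp
  qed
  ultimately show False by simp
qed

section \<open>Complete monotonicity\<close>

text \<open>\<open>E x\<close> is the Kilbas--Saigo function at \<open>- x\<close>, which is where the equation evaluates it, with
  \<open>x = H \<beta>\<^sup>2 t\<^bsup>\<gamma>\<^esup>\<close>.\<close>

definition E :: "real \<Rightarrow> real" where "E x = power_series c (- x)"

definition E_coeff :: "nat \<Rightarrow> real" where "E_coeff k = (-1) ^ k * c k"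

definition dE :: "nat \<Rightarrow> real \<Rightarrow> real" where "dE n = power_series ((diffs ^^ n) E_coeff)"

text \<open>The coefficients of \<open>(-x)\<^sup>n E\<^bsup>(n)\<^esup>(x) / n!\<close>, whose nonnegativity for \<open>x > 0\<close> is
  complete monotonicity of \<open>E\<close>.\<close>

definition mono_coeff :: "nat \<Rightarrow> nat \<Rightarrow> real" where
  "mono_coeff n k = (-1) ^ n * (E_coeff k * real (k choose n))"

lemma entire_E_coeff: "entire_coeffs E_coeff"
  using entire_coeffs_scale[OF entire_coeff, of "-1"] by (simp add: E_coeff_def[abs_def])

lemma dE_0: "dE 0 = E"
  using power_series_scale[of "-1" c] by (auto simp: dE_def E_def E_coeff_def[abs_def])

lemma dE_deriv: "(dE n has_real_derivative dE (Suc n) x) (at x)"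
  unfolding dE_def using power_series_deriv[OF entire_coeffs_funpow_diffs[OF entire_E_coeff]] by simp

lemma entire_binomial_E_coeff: "entire_coeffs (\<lambda>k. E_coeff k * real (k choose n))"
  using entire_binomial_coeff[of "-1" n] by (simp add: E_coeff_def)

lemma entire_mono_coeff: "entire_coeffs (mono_coeff n)"
  unfolding mono_coeff_def[abs_def] by (intro entire_coeffs_cmult entire_binomial_E_coeff)

text \<open>The next two lemmas are the differential equations
  \<open>D\<^sup>\<nu> Z\<^sub>0 = - t\<^bsup>\<gamma>-\<nu>\<^esup> Z\<^sub>0\<close> and \<open>D\<^sup>\<nu> Z\<^bsub>n+1\<^esub> = t\<^bsup>\<gamma>-\<nu>\<^esup> (Z\<^sub>n - Z\<^bsub>n+1\<^esub>)\<close> in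
  terms of coefficients; the second is the Pascal rule for \<open>Suc k choose Suc n\<close>.\<close>

lemma mono_coeff_shift_0: "mono_coeff 0 (Suc k) / \<rho> k = - mono_coeff 0 k"
  using ratio_pos[of k] by (simp add: mono_coeff_def E_coeff_def coeff_Suc)

lemma mono_coeff_shift_Suc: "mono_coeff (Suc n) (Suc k) / \<rho> k = - mono_coeff (Suc n) k + mono_coeff n k"
  using ratio_pos[of k] by (simp add: mono_coeff_def E_coeff_def coeff_Suc field_simps)

text \<open>Where \<open>Z\<^bsub>n+1\<^esub>\<close> is negative its Caputo derivative \<open>t\<^bsup>\<gamma>-\<nu>\<^esup> (Z\<^sub>n - Z\<^bsub>n+1\<^esub>)\<close> is positive, by the induction
  hypothesis on \<open>Z\<^sub>n\<close>; so the comparison principle propagates nonnegativity from \<open>n\<close> to \<open>n + 1\<close>.\<close>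

lemma mono_series_nonneg_powr: "0 \<le> t \<Longrightarrow> 0 \<le> power_series (mono_coeff n) (t powr \<gamma>)"
proof (induction n arbitrary: t)
  case 0
  let ?X = "\<lambda>s. complex_of_real (power_series (mono_coeff 0) (s powr \<gamma>))"
  have "0 \<le> Re (?X t)"
  proof (rule caputo_comparison[OF nu, where f = ?X and t = t])
    show "continuous_on {0..} ?X"
      by (intro continuous_on_of_real continuous_power_series_powr entire_mono_coeff gam)
    show "0 \<le> Re (?X 0)"
      using coeff_0 by (simp add: power_series_0 mono_coeff_def E_coeff_def)
    fix s :: real assume s: "0 < s"
    show "caputo_differentiable \<nu> ?X s"
      by (rule caputo_power_series_powr(1)[OF entire_mono_coeff s])
    show "0 < Re (caputo_deriv \<nu> ?X s)" if "Re (?X s) < 0"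
      unfolding caputo_power_series_powr(2)[OF entire_mono_coeff s] mono_coeff_shift_0
      using that s by (simp add: power_series_uminus entire_mono_coeff mult_less_0_iff)
  qed fact
  then show ?case by simp
next
  case (Suc n)
  let ?X = "\<lambda>s. complex_of_real (power_series (mono_coeff (Suc n)) (s powr \<gamma>))"
  have "0 \<le> Re (?X t)"
  proof (rule caputo_comparison[OF nu, where f = ?X and t = t])
    show "continuous_on {0..} ?X"
      by (intro continuous_on_of_real continuous_power_series_powr entire_mono_coeff gam)
    show "0 \<le> Re (?X 0)"
      by (simp add: power_series_0 mono_coeff_def)
    fix s :: real assume s: "0 < s"
    show "caputo_differentiable \<nu> ?X s"
      by (rule caputo_power_series_powr(1)[OF entire_mono_coeff s])
    show "0 < Re (caputo_deriv \<nu> ?X s)" if "Re (?X s) < 0"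
    proof -
      have "power_series (\<lambda>k. - mono_coeff (Suc n) k + mono_coeff n k) (s powr \<gamma>) =
          - power_series (mono_coeff (Suc n)) (s powr \<gamma>) + power_series (mono_coeff n) (s powr \<gamma>)"
        using entire_coeffs_cmult[OF entire_mono_coeff, of "-1"]
        by (subst power_series_add) (auto simp: power_series_uminus entire_mono_coeff)
      also have "\<dots> > 0" using that Suc.IH[of s] s by simp
      finally show ?thesis
        unfolding caputo_power_series_powr(2)[OF entire_mono_coeff s] mono_coeff_shift_Suc
        using s by simp
    qed
  qed fact
  then show ?case by simp
qed

lemma mono_series_nonneg:
  assumes "0 \<le> x" shows "0 \<le> power_series (mono_coeff n) x"
proof (cases "x = 0")
  case True
  then show ?thesis by (cases n) (auto simp: power_series_0 mono_coeff_def E_coeff_def coeff_0)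
next
  case False
  then show ?thesis
    using mono_series_nonneg_powr[of "x powr (1 / \<gamma>)" n] assms gam by (simp add: powr_powr)
qed

lemma E_completely_monotone:
  assumes x: "0 < x" shows "0 \<le> (-1) ^ n * dE n x"
proof -
  have "x ^ n * ((-1) ^ n * dE n x) = (-1) ^ n * (fact n * power_series (\<lambda>k. E_coeff k * real (k choose n)) x)"
    unfolding dE_def power_series_funpow_diffs[OF entire_binomial_E_coeff, symmetric] by simp
  also have "\<dots> = fact n * power_series (mono_coeff n) x"
    unfolding mono_coeff_def by (subst power_series_cmult[OF entire_binomial_E_coeff]) simp
  also have "\<dots> \<ge> 0" using mono_series_nonneg[of x n] x by simp
  finally have "x ^ n * 0 \<le> x ^ n * ((-1) ^ n * dE n x)" by (simp only: mult_zero_right)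
  then show ?thesis using x by (simp only: mult_le_cancel_left_pos zero_less_power)
qed

lemma signed_dE_antimono:
  assumes "0 < x" "x \<le> y" shows "(-1) ^ n * dE n y \<le> (-1) ^ n * dE n x"
proof (rule DERIV_nonpos_imp_nonincreasing[OF assms(2)])
  fix z assume "x \<le> z" "z \<le> y"
  then have "0 \<le> (-1) ^ Suc n * dE (Suc n) z" using assms by (intro E_completely_monotone) auto
  moreover have "((\<lambda>x. (-1) ^ n * dE n x) has_real_derivative (-1) ^ n * dE (Suc n) z) (at z)"
    by (intro DERIV_cmult dE_deriv)
  ultimately show "\<exists>d. ((\<lambda>x. (-1) ^ n * dE n x) has_real_derivative d) (at z) \<and> d \<le> 0"
    by auto
qed

section \<open>Decay, and the inverse Fourier transform\<close>

text \<open>The Volterra form of \<open>D\<^sup>\<nu> V = - t\<^bsup>\<gamma>-\<nu>\<^esup> V\<close>, \<open>V 0 = 1\<close>, for \<open>V t = E (t powr \<gamma>)\<close>. It is read off from the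
  coefficients, since \<open>\<rho> k\<close> is a Beta integral.\<close>

lemma E_integral_equation:
  assumes t: "0 < t"
  shows "(LINT s:{0<..<t}|lborel. (t - s) powr (\<nu> - 1) * s powr (\<gamma> - \<nu>) * E (s powr \<gamma>)) =
    Gamma \<nu> * (1 - E (t powr \<gamma>))" (is "?I = _")
proof -
  let ?x = "t powr \<gamma>"
  have p: "0 < \<gamma> + 1 - \<nu>" using gam nu by simp
  have Gn: "0 < Gamma \<nu>" using nu by (intro Gamma_real_pos) auto
  have "(\<lambda>k. E_coeff k * Beta (\<gamma> + 1 - \<nu> + \<gamma> * real k) \<nu> * ?x ^ k) sums (?I / ?x)"
    using beta_kernel_power_series(2)[OF p nu(1) gam t entire_E_coeff] fun_cong[OF dE_0]
    by (simp add: dE_def)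
  from sums_mult[OF this, of "- ?x / Gamma \<nu>"]
  have "(\<lambda>k. E_coeff (Suc k) * ?x ^ Suc k) sums (- ?I / Gamma \<nu>)"
  proof (rule back_subst[where P = "\<lambda>f. f sums _", THEN back_subst[where P = "\<lambda>v. _ sums v"]])
    show "(\<lambda>k. - ?x / Gamma \<nu> * (E_coeff k * Beta (\<gamma> + 1 - \<nu> + \<gamma> * real k) \<nu> * ?x ^ k)) =
        (\<lambda>k. E_coeff (Suc k) * ?x ^ Suc k)"
      by (simp add: E_coeff_def coeff_Suc ratio_eq_Beta fun_eq_iff)
    show "- ?x / Gamma \<nu> * (?I / ?x) = - ?I / Gamma \<nu>"
      using t by simp
  qed
  then have "(\<lambda>k. E_coeff k * ?x ^ k) sums (- ?I / Gamma \<nu> + 1)"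
    by (subst (asm) sums_Suc_iff) (simp add: E_coeff_def coeff_0)
  then have "E ?x = - ?I / Gamma \<nu> + 1"
    using fun_cong[OF dE_0, of ?x] by (simp add: dE_def power_series_def sums_iff)
  then show ?thesis using Gn by (simp add: field_simps)
qed

text \<open>In the integral equation \<open>E\<close> is at least its value at the right end point, because it is
  decreasing, and the right-hand side is at most \<open>Gamma \<nu>\<close>, because \<open>E\<close> is nonnegative.\<close>

lemma E_decay:
  assumes x: "0 < x" shows "E x \<le> 1 / (\<rho> 0 * x)"
proof -
  define t where "t = x powr (1 / \<gamma>)"
  have t: "0 < t" and tx: "t powr \<gamma> = x" using x gam by (auto simp: t_def powr_powr)
  have p: "0 < \<gamma> + 1 - \<nu>" using gam nu by simp
  have Gn: "0 < Gamma \<nu>" using nu by (intro Gamma_real_pos) auto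
  have E_nonneg: "0 \<le> E y" if "0 < y" for y using E_completely_monotone[OF that, of 0] by (simp add: dE_0)
  let ?w = "\<lambda>s. (t - s) powr (\<nu> - 1) * s powr (\<gamma> - \<nu>)"
  have w: "set_integrable lborel {0<..<t} ?w"
    and wI: "(LINT s:{0<..<t}|lborel. ?w s) = x * (Gamma \<nu> * \<rho> 0)"
    using beta_kernel[OF p nu(1) t] Gn by (simp_all add: tx ratio_eq_Beta)
  have wE: "set_integrable lborel {0<..<t} (\<lambda>s. ?w s * E (s powr \<gamma>))"
    using beta_kernel_power_series(1)[OF p nu(1) gam t entire_E_coeff] fun_cong[OF dE_0]
    by (simp add: dE_def)
  have "x * (Gamma \<nu> * \<rho> 0) * E x = (LINT s:{0<..<t}|lborel. ?w s * E x)"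
    by (simp add: wI)
  also have "\<dots> \<le> (LINT s:{0<..<t}|lborel. ?w s * E (s powr \<gamma>))"
  proof (rule set_integral_mono)
    fix s assume s: "s \<in> {0<..<t}"
    then have "s powr \<gamma> \<le> x" unfolding tx[symmetric] using gam by (intro powr_mono2) auto
    then have "E x \<le> E (s powr \<gamma>)"
      using signed_dE_antimono[of "s powr \<gamma>" x 0] s by (simp add: dE_0)
    then show "?w s * E x \<le> ?w s * E (s powr \<gamma>)" by (intro mult_left_mono) auto
  qed (use w wE in auto)
  also have "\<dots> \<le> Gamma \<nu>"
    unfolding E_integral_equation[OF t] tx using E_nonneg[OF x] Gn by (simp add: mult_left_le)
  finally have "E x * (\<rho> 0 * x) \<le> 1" using Gn by (simp add: field_simps)
  then show ?thesis using x ratio_pos[of 0] by (simp add: field_simps)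
qed

text \<open>The signed derivative \<open>h\<^sub>n = (-1)\<^sup>n E\<^bsup>(n)\<^esup>\<close> is nonnegative and \<open>h\<^bsub>n+1\<^esub> = - h\<^sub>n'\<close> is decreasing, so
  \<open>(x/2) h\<^bsub>n+1\<^esub>(x) \<le> h\<^sub>n(x/2) - h\<^sub>n(x) \<le> h\<^sub>n(x/2)\<close>: each derivative gains a factor \<open>1/x\<close>.\<close>

lemma dE_decay: "\<exists>A. \<forall>x>0. (-1) ^ n * dE n x \<le> A / x ^ Suc n"
proof (induction n)
  case 0
  show ?case
    using E_decay by (intro exI[of _ "1 / \<rho> 0"]) (simp add: dE_0)
next
  case (Suc n)
  then obtain A where A: "\<And>x. 0 < x \<Longrightarrow> (-1) ^ n * dE n x \<le> A / x ^ Suc n" by blast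
  show ?case
  proof (intro exI[of _ "A * 2 ^ (n + 2)"] allI impI)
    fix x :: real assume x: "0 < x"
    let ?h = "\<lambda>n x. (-1) ^ n * dE n x"
    have "(?h n has_real_derivative (-1) ^ n * dE (Suc n) y) (at y)" for y
      by (intro DERIV_cmult dE_deriv)
    from MVT2[of "x / 2" x "?h n", OF _ this]
    obtain z where z: "x / 2 < z" "z < x"
      "?h n x - ?h n (x / 2) = (x - x / 2) * ((-1) ^ n * dE (Suc n) z)"
      using x by auto
    then have "?h n (x / 2) - ?h n x = x / 2 * ?h (Suc n) z" by simp
    moreover have "x / 2 * ?h (Suc n) x \<le> x / 2 * ?h (Suc n) z"
      using x z by (intro mult_left_mono signed_dE_antimono) auto
    moreover have "0 \<le> ?h n x" by (rule E_completely_monotone[OF x])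
    ultimately have "x / 2 * ?h (Suc n) x \<le> ?h n (x / 2)" by linarith
    also have "\<dots> \<le> A / (x / 2) ^ Suc n" using x by (intro A) auto
    finally have "?h (Suc n) x \<le> (A / (x / 2) ^ Suc n) / (x / 2)"
      using x by (subst pos_le_divide_eq) (auto simp: mult.commute)
    also have "\<dots> = A * 2 ^ (n + 2) / x ^ Suc (Suc n)"
      using x by (simp add: power_divide field_simps)
    finally show "?h (Suc n) x \<le> A * 2 ^ (n + 2) / x ^ Suc (Suc n)" .
  qed
qed

lemma dE_bound: "\<exists>K\<ge>0. \<forall>x\<ge>0. \<bar>dE n x\<bar> \<le> K / (1 + x) ^ Suc n"
proof -
  obtain A where A: "\<And>x. 0 < x \<Longrightarrow> (-1) ^ n * dE n x \<le> A / x ^ Suc n"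
    using dE_decay by blast
  have "continuous_on {0..1} (dE n)"
    using dE_deriv by (meson DERIV_continuous_on has_field_derivative_at_within)
  then have "compact (dE n ` {0..1})" by (intro compact_continuous_image) auto
  then obtain B where "\<forall>x\<in>{0..1}. \<bar>dE n x\<bar> \<le> B"
    using compact_imp_bounded[of "dE n ` {0..1}"] by (auto simp: bounded_iff)
  then have B: "\<bar>dE n x\<bar> \<le> B" if "0 \<le> x" "x \<le> 1" for x using that by simp
  have B0: "0 \<le> B" using B[of 0] by simp
  have A0: "0 \<le> A"
    using order_trans[OF E_completely_monotone[of 1 n] A[of 1]] by simp
  show ?thesis
  proof (intro exI[of _ "(A + B) * 2 ^ Suc n"] conjI allI impI)
    show "0 \<le> (A + B) * 2 ^ Suc n" using A0 B0 by simp
    fix x :: real assume x: "0 \<le> x"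
    show "\<bar>dE n x\<bar> \<le> (A + B) * 2 ^ Suc n / (1 + x) ^ Suc n"
    proof (cases "x \<le> 1")
      case True
      have "\<bar>dE n x\<bar> * (1 + x) ^ Suc n \<le> (A + B) * 2 ^ Suc n"
        using B[OF x True] A0 x True by (intro mult_mono power_mono) auto
      then show ?thesis using x by (subst pos_le_divide_eq) auto
    next
      case False
      have "\<bar>dE n x\<bar> = \<bar>(-1) ^ n * dE n x\<bar>" by (simp add: abs_mult)
      also have "\<dots> = (-1) ^ n * dE n x" using False by (intro abs_of_nonneg E_completely_monotone) simp
      also have "\<dots> \<le> A / x ^ Suc n" using False by (intro A) simp
      finally have "\<bar>dE n x\<bar> * x ^ Suc n \<le> A" using False by (subst (asm) pos_le_divide_eq) auto
      then have *: "\<bar>dE n x\<bar> * x ^ Suc n * 2 ^ Suc n \<le> (A + B) * 2 ^ Suc n"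
        using B0 by (intro mult_right_mono) auto
      have "\<bar>dE n x\<bar> * (1 + x) ^ Suc n \<le> \<bar>dE n x\<bar> * (x * 2) ^ Suc n"
        using False by (intro mult_left_mono power_mono) auto
      also have "\<dots> = \<bar>dE n x\<bar> * x ^ Suc n * 2 ^ Suc n" unfolding power_mult_distrib by simp
      also note *
      finally show ?thesis using x by (subst pos_le_divide_eq) auto
    qed
  qed
qed

text \<open>The three functions are \<open>b \<mapsto> E (\<kappa> b\<^sup>2)\<close> and its first two derivatives. With
  \<open>y = 1 + \<kappa> b\<^sup>2\<close> they are \<open>O(1/y)\<close>, \<open>O(\<bar>b\<bar>/y\<^sup>2)\<close> and \<open>O(1/y\<^sup>2 + b\<^sup>2/y\<^sup>3)\<close>, hence all \<open>O(1/y)\<close>, and \<open>y\<close> is comparable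
  to \<open>1 + b\<^sup>2\<close>.\<close>

lemma E_quadratic_bounds:
  assumes kap: "0 < \<kappa>"
  obtains K where "\<And>b. \<bar>E (\<kappa> * b\<^sup>2)\<bar> \<le> K / (1 + b\<^sup>2)"
    "\<And>b. \<bar>2 * \<kappa> * b * dE 1 (\<kappa> * b\<^sup>2)\<bar> \<le> K / (1 + b\<^sup>2)"
    "\<And>b. \<bar>2 * \<kappa> * dE 1 (\<kappa> * b\<^sup>2) + 4 * \<kappa>\<^sup>2 * b\<^sup>2 * dE 2 (\<kappa> * b\<^sup>2)\<bar> \<le> K / (1 + b\<^sup>2)"
proof -
  obtain K0 K1 K2 where K: "0 \<le> K0" "0 \<le> K1" "0 \<le> K2"
    and K0: "\<And>x. 0 \<le> x \<Longrightarrow> \<bar>dE 0 x\<bar> \<le> K0 / (1 + x) ^ Suc 0"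
    and K1: "\<And>x. 0 \<le> x \<Longrightarrow> \<bar>dE 1 x\<bar> \<le> K1 / (1 + x) ^ Suc 1"
    and K2: "\<And>x. 0 \<le> x \<Longrightarrow> \<bar>dE 2 x\<bar> \<le> K2 / (1 + x) ^ Suc 2"
    using dE_bound[of 0] dE_bound[of 1] dE_bound[of 2] by metis
  define m where "m = min 1 \<kappa>"
  have m: "0 < m" "m \<le> 1" "m \<le> \<kappa>" using kap by (auto simp: m_def)
  define L where "L = K0 + (1 + \<kappa>) * K1 + (2 * \<kappa> * K1 + 4 * \<kappa> * K2)"
  have L: "K0 \<le> L" "(1 + \<kappa>) * K1 \<le> L" "2 * \<kappa> * K1 + 4 * \<kappa> * K2 \<le> L" "0 \<le> L"
    using K kap by (auto simp: L_def intro!: add_nonneg_nonneg mult_nonneg_nonneg)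
  have conv: "z \<le> (L / m) / (1 + b\<^sup>2)" if "z \<le> B / (1 + \<kappa> * b\<^sup>2)" "B \<le> L" for z B b :: real
  proof -
    have pos: "0 < 1 + b\<^sup>2" "0 < 1 + \<kappa> * b\<^sup>2" using kap by (auto intro: add_pos_nonneg)
    have "m * (1 + b\<^sup>2) \<le> 1 + \<kappa> * b\<^sup>2"
      using m mult_right_mono[OF m(3), of "b\<^sup>2"] by (simp add: algebra_simps)
    then have "L * (m * (1 + b\<^sup>2)) \<le> L * (1 + \<kappa> * b\<^sup>2)" using L(4) by (rule mult_left_mono)
    then have "L / (1 + \<kappa> * b\<^sup>2) \<le> L / (m * (1 + b\<^sup>2))"
      using pos m(1) by (intro frac_le) (use L(4) \<open>m * (1 + b\<^sup>2) \<le> 1 + \<kappa> * b\<^sup>2\<close> in auto)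
    moreover have "B / (1 + \<kappa> * b\<^sup>2) \<le> L / (1 + \<kappa> * b\<^sup>2)"
      using pos that(2) by (intro divide_right_mono) auto
    ultimately show ?thesis using that(1) by simp
  qed
  show ?thesis
  proof (rule that[of "L / m"])
    fix b :: real
    define y where "y = 1 + \<kappa> * b\<^sup>2"
    have x: "0 \<le> \<kappa> * b\<^sup>2" using kap by simp
    then have y: "1 \<le> y" "0 < y" by (auto simp: y_def)
    have d1: "\<bar>dE 1 (\<kappa> * b\<^sup>2)\<bar> \<le> K1 / y\<^sup>2" using K1[OF x] by (simp add: y_def power2_eq_square)
    have d1': "K1 / y\<^sup>2 \<le> K1 / y"
      using y K by (intro divide_left_mono) (auto simp: power2_eq_square)
    show "\<bar>E (\<kappa> * b\<^sup>2)\<bar> \<le> (L / m) / (1 + b\<^sup>2)"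
      by (rule conv[OF _ L(1)]) (use K0[OF x] in \<open>simp add: dE_0\<close>)
    show "\<bar>2 * \<kappa> * b * dE 1 (\<kappa> * b\<^sup>2)\<bar> \<le> (L / m) / (1 + b\<^sup>2)"
    proof (rule conv[OF _ L(2)])
      have "2 * \<bar>b\<bar> \<le> 1 + b\<^sup>2" using zero_le_power2[of "\<bar>b\<bar> - 1"] by (simp add: power2_diff)
      then have "\<kappa> * (2 * \<bar>b\<bar>) \<le> \<kappa> * (1 + b\<^sup>2)" using kap by (intro mult_left_mono) auto
      also have "\<dots> \<le> (1 + \<kappa>) * y" using kap by (simp add: y_def algebra_simps)
      finally have "2 * \<kappa> * \<bar>b\<bar> \<le> (1 + \<kappa>) * y" by (simp only: mult_ac)
      from mult_mono[OF this d1]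
      have "(2 * \<kappa> * \<bar>b\<bar>) * \<bar>dE 1 (\<kappa> * b\<^sup>2)\<bar> \<le> ((1 + \<kappa>) * y) * (K1 / y\<^sup>2)"
        using kap y by simp
      also have "\<dots> = (1 + \<kappa>) * K1 / y" using y by (simp add: power2_eq_square)
      finally show "\<bar>2 * \<kappa> * b * dE 1 (\<kappa> * b\<^sup>2)\<bar> \<le> (1 + \<kappa>) * K1 / (1 + \<kappa> * b\<^sup>2)"
        using kap by (simp add: abs_mult y_def)
    qed
    show "\<bar>2 * \<kappa> * dE 1 (\<kappa> * b\<^sup>2) + 4 * \<kappa>\<^sup>2 * b\<^sup>2 * dE 2 (\<kappa> * b\<^sup>2)\<bar> \<le> (L / m) / (1 + b\<^sup>2)"
    proof (rule conv[OF _ L(3)])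
      have "\<bar>2 * \<kappa> * dE 1 (\<kappa> * b\<^sup>2)\<bar> \<le> 2 * \<kappa> * (K1 / y)"
      proof -
        have "2 * \<kappa> * \<bar>dE 1 (\<kappa> * b\<^sup>2)\<bar> \<le> 2 * \<kappa> * (K1 / y)"
          using order_trans[OF d1 d1'] kap by (intro mult_left_mono) auto
        then show ?thesis using kap by (simp add: abs_mult)
      qed
      moreover have "\<bar>4 * \<kappa>\<^sup>2 * b\<^sup>2 * dE 2 (\<kappa> * b\<^sup>2)\<bar> \<le> 4 * \<kappa> * (K2 / y)"
      proof -
        have "(\<kappa> * b\<^sup>2) * \<bar>dE 2 (\<kappa> * b\<^sup>2)\<bar> \<le> y * (K2 / y ^ 3)"
          using K2[OF x] x by (intro mult_mono) (auto simp: y_def numeral_3_eq_3)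
        also have "\<dots> = K2 / y\<^sup>2" using y by (simp add: power2_eq_square power3_eq_cube)
        also have "\<dots> \<le> K2 / y" using y K by (intro divide_left_mono) (auto simp: power2_eq_square)
        finally have "4 * \<kappa> * ((\<kappa> * b\<^sup>2) * \<bar>dE 2 (\<kappa> * b\<^sup>2)\<bar>) \<le> 4 * \<kappa> * (K2 / y)"
          using kap by (intro mult_left_mono) auto
        then show ?thesis using kap by (simp add: abs_mult power2_eq_square mult_ac)
      qed
      ultimately have "\<bar>2 * \<kappa> * dE 1 (\<kappa> * b\<^sup>2) + 4 * \<kappa>\<^sup>2 * b\<^sup>2 * dE 2 (\<kappa> * b\<^sup>2)\<bar> \<le> 2 * \<kappa> * (K1 / y) + 4 * \<kappa> * (K2 / y)"
        by linarith
      then show "\<bar>2 * \<kappa> * dE 1 (\<kappa> * b\<^sup>2) + 4 * \<kappa>\<^sup>2 * b\<^sup>2 * dE 2 (\<kappa> * b\<^sup>2)\<bar> \<le> (2 * \<kappa> * K1 + 4 * \<kappa> * K2) / (1 + \<kappa> * b\<^sup>2)"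
        by (simp add: y_def add_divide_distrib)
    qed
  qed
qed

lemma E_inverse_transform:
  assumes kap: "0 < \<kappa>"
  defines "u \<equiv> \<lambda>x. of_real (1 / (2 * pi)) * (LINT b|lborel. cis (- (b * x)) * of_real (E (\<kappa> * b\<^sup>2)))"
  shows "integrable lborel u" and "(LINT x|lborel. cis (b * x) * u x) = of_real (E (\<kappa> * b\<^sup>2))"
proof -
  let ?F = "\<lambda>b. complex_of_real (E (\<kappa> * b\<^sup>2))"
  let ?F1 = "\<lambda>b. complex_of_real (2 * \<kappa> * b * dE 1 (\<kappa> * b\<^sup>2))"
  let ?F2 = "\<lambda>b. complex_of_real (2 * \<kappa> * dE 1 (\<kappa> * b\<^sup>2) + 4 * \<kappa>\<^sup>2 * b\<^sup>2 * dE 2 (\<kappa> * b\<^sup>2))"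
  obtain K where K: "\<And>b. \<bar>E (\<kappa> * b\<^sup>2)\<bar> \<le> K / (1 + b\<^sup>2)"
    "\<And>b. \<bar>2 * \<kappa> * b * dE 1 (\<kappa> * b\<^sup>2)\<bar> \<le> K / (1 + b\<^sup>2)"
    "\<And>b. \<bar>2 * \<kappa> * dE 1 (\<kappa> * b\<^sup>2) + 4 * \<kappa>\<^sup>2 * b\<^sup>2 * dE 2 (\<kappa> * b\<^sup>2)\<bar> \<le> K / (1 + b\<^sup>2)"
    using E_quadratic_bounds[OF kap] by blast
  have q: "((\<lambda>b. \<kappa> * b\<^sup>2) has_real_derivative 2 * \<kappa> * b) (at b)" for b
    by (auto intro!: derivative_eq_intros)
  have dn: "((\<lambda>b. dE n (\<kappa> * b\<^sup>2)) has_real_derivative dE (Suc n) (\<kappa> * b\<^sup>2) * (2 * \<kappa> * b)) (at b)" for n b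
    by (rule DERIV_chain2[OF dE_deriv q])
  have d1: "(?F has_vector_derivative ?F1 b) (at b)" for b
    using dn[of 0 b] by (intro has_vector_derivative_of_real)
      (simp add: dE_0 has_real_derivative_iff_has_vector_derivative mult_ac)
  have "((\<lambda>b. 2 * \<kappa> * b * dE 1 (\<kappa> * b\<^sup>2)) has_real_derivative
      2 * \<kappa> * dE 1 (\<kappa> * b\<^sup>2) + 4 * \<kappa>\<^sup>2 * b\<^sup>2 * dE 2 (\<kappa> * b\<^sup>2)) (at b)" for b
    using dn[of 1 b] by (auto intro!: derivative_eq_intros simp: power2_eq_square numeral_2_eq_2 algebra_simps)
  then have d2: "(?F1 has_vector_derivative ?F2 b) (at b)" for b
    by (intro has_vector_derivative_of_real) (simp add: has_real_derivative_iff_has_vector_derivative)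
  have cdE: "isCont (\<lambda>b. dE n (\<kappa> * b\<^sup>2)) b" for n b
    using dn by (rule DERIV_isCont)
  have c2: "isCont ?F2 b" for b
    by (intro continuous_intros cdE isCont_of_real)
  note ints = fourier_integral_integrable[OF d1 d2 c2, of K]
  have norms: "norm (?F b) \<le> K / (1 + b\<^sup>2)" "norm (?F1 b) \<le> K / (1 + b\<^sup>2)" "norm (?F2 b) \<le> K / (1 + b\<^sup>2)" for b
    using K[of b] by (simp_all only: norm_of_real)
  have F: "integrable lborel ?F" and uF: "integrable lborel (\<lambda>x. LINT b|lborel. cis (- (b * x)) * ?F b)"
    by (rule ints[OF norms])+
  show u: "integrable lborel u"
    unfolding u_def by (intro integrable_mult_right uF)
  have K0: "0 \<le> K" using K(1)[of 0] by simp
  have "norm (?F b) \<le> K" for b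
    using norms(1)[of b] K0 by (auto intro: order_trans simp: divide_le_eq mult_left_le_one_le add_pos_nonneg algebra_simps)
  moreover have "isCont ?F b" for b using d1 by (rule has_vector_derivative_continuous)
  ultimately show "(LINT x|lborel. cis (b * x) * u x) = ?F b"
    using fourier_inversion[OF F, of K b] u unfolding u_def by blast
qed

end

section \<open>The fundamental solution\<close>

theorem theorem4p1:
  fixes \<nu> H :: real
  assumes "0 < \<nu>" "\<nu> \<le> 1" "0 < H" "H < 1" "\<nu> + 2 * H - 1 > 0"
  shows "fourier_solution \<nu> H (fourier_representation \<nu> H) \<and>
    (\<forall>u. fourier_solution \<nu> H u \<longrightarrow>
       (\<forall>t>0. AE x in lborel. u x t = fourier_representation \<nu> H x t))"
proof -
  define \<gamma> where "\<gamma> = \<nu> + 2 * H - 1"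
  interpret kilbas_saigo_params \<nu> \<gamma> using assms by unfold_locales (auto simp: \<gamma>_def)
  define V where "V b t = complex_of_real (power_series c (- (H * b\<^sup>2) * t powr \<gamma>))" for b t :: real
  let ?u = "fourier_representation \<nu> H"
  have V_E: "V b t = of_real (E (H * t powr \<gamma> * b\<^sup>2))" for b t
    by (simp add: V_def E_def mult_ac)
  have u_eq: "?u x t = of_real (1 / (2 * pi)) * (LINT b|lborel. cis (- (b * x)) * V b t)" for x t
  proof -
    have "kilbas_saigo \<nu> (1 + (2 * H - 1) / \<nu>) ((2 * H - 1) / \<nu>)
        (of_real (- H * b\<^sup>2 * t powr (\<nu> + 2 * H - 1))) = V b t" for b
      by (subst kilbas_saigo_eq) (simp_all add: \<gamma>_def V_def)
    then show ?thesis by (simp add: fourier_representation_def)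
  qed
  have transform: "integrable lborel (\<lambda>x. ?u x t)" "(LINT x|lborel. cis (b * x) * ?u x t) = V b t"
    if "0 < t" for t b
    using E_inverse_transform[of "H * t powr \<gamma>"] that assms by (simp_all add: u_eq V_E)
  have V_cont: "continuous_on {0..} (V b)" for b
    unfolding V_def by (intro continuous_on_of_real continuous_series_solution)
  have V_0: "V b 0 = 1" for b
    by (simp add: V_def power_series_0 coeff_0)
  have V_cd: "caputo_differentiable \<nu> (V b) t" if "0 < t" for b t
    unfolding V_def[abs_def] by (rule caputo_series_solution(1)[OF that])
  have exps: "\<gamma> - \<nu> = 2 * H - 1" by (simp add: \<gamma>_def)
  have V_eq: "caputo_deriv \<nu> (V b) t = - of_real (H * b\<^sup>2 * t powr (\<gamma> - \<nu>)) * V b t" if "0 < t" for b t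
    unfolding V_def[abs_def] caputo_series_solution(2)[OF that] by simp
  have solution: "fourier_solution \<nu> H ?u"
    unfolding fourier_solution_def
    by (intro conjI exI[of _ V] allI impI)
       (use transform V_cont V_0 V_cd V_eq in \<open>simp_all add: exps mult_ac\<close>)
  moreover have "AE x in lborel. u x t = ?u x t" if u: "fourier_solution \<nu> H u" and t: "0 < t" for u t
  proof -
    from u obtain U where
      u_int: "\<And>t. 0 < t \<Longrightarrow> integrable lborel (\<lambda>x. u x t)"
      and U: "\<And>b t. 0 < t \<Longrightarrow> U b t = (LINT x|lborel. cis (b * x) * u x t)"
      and U_0: "\<And>b. U b 0 = 1" and U_cont: "\<And>b. continuous_on {0..} (U b)"
      and U_cd: "\<And>b t. 0 < t \<Longrightarrow> caputo_differentiable \<nu> (U b) t"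
      and U_eq: "\<And>b t. 0 < t \<Longrightarrow> caputo_deriv \<nu> (U b) t = - of_real (H * t powr (2 * H - 1) * b\<^sup>2) * U b t"
      unfolding fourier_solution_def by blast
    have "U b t = V b t" for b
    proof (rule caputo_linear_equation_unique[where r = "H * b\<^sup>2" and U = "U b" and V = "V b"])
      show "caputo_deriv \<nu> (U b) t = - of_real (H * b\<^sup>2 * t powr (\<gamma> - \<nu>)) * U b t" if "0 < t" for t
        using U_eq[OF that, of b] by (simp add: exps mult_ac)
    qed (use assms U_0 V_0 U_cont V_cont U_cd V_cd V_eq t in auto)
    then show ?thesis
      using t by (intro fourier_unique u_int transform(1)) (simp_all add: transform(2) U)
  qed
  ultimately show ?thesis by blast
qed

end
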